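(* For every quadratic irrational $\alpha$ there is a constant $K(\alpha)>0$, depending only on $\alpha$, such that for every $-\infty\le p\le\infty$, $p\ne0$, there is a constant $C_p(\alpha)\in\mathbb{R}$ with \[ \left|\log J_{p,M}(\alpha)-C_p(\alpha)\log M\right|\le K(\alpha)\max\{1,1/|p|\}\qquad\text{for all } M\in\mathbb{N}. \]
   Context: $\{x\}=x-\lfloor x\rfloor$, and $S_N(\alpha)=\sum_{n=1}^N(\{n\alpha\}-1/2)$, $S_0(\alpha)=0$. For $\alpha\in\mathbb{R}$ and $M\in\mathbb{N}$ (a positive integer), \[ J_{p,M}(\alpha)=\left(\sum_{N=0}^{M-1}e^{pS_N(\alpha)}\right)^{1/p}\ (p\ne\pm\infty,0),\quad J_{\infty,M}(\alpha)=\max_{0\le N<M}e^{S_N(\alpha)},\quad J_{-\infty,M}(\alpha)=\min_{0\le N<M}e^{S_N(\alpha)}. \] Convention: $1/|p|=0$ for $p=\pm\infty$. *)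

theory Defs
  imports Complex_Main "HOL-Library.Extended_Real"
begin

definition quadratic_irrational :: "real \<Rightarrow> bool" where
  "quadratic_irrational \<alpha> \<longleftrightarrow>
     \<alpha> \<notin> \<rat> \<and>
     (\<exists>a b c :: int. a \<noteq> 0 \<and> of_int a * \<alpha>\<^sup>2 + of_int b * \<alpha> + of_int c = 0)"

definition S :: "nat \<Rightarrow> real \<Rightarrow> real" where
  "S N \<alpha> = (\<Sum>n=1..N. frac (real n * \<alpha>) - 1/2)"

text \<open>The value at \<open>p = 0\<close> or \<open>M = 0\<close> carries no meaning.\<close>

definition J :: "ereal \<Rightarrow> nat \<Rightarrow> real \<Rightarrow> real" where
  "J p M \<alpha> =
     (case p of
        ereal r \<Rightarrow> (\<Sum>N<M. exp (r * S N \<alpha>)) powr (1 / r)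
      | PInfty \<Rightarrow> (MAX N\<in>{..<M}. exp (S N \<alpha>))
      | MInfty \<Rightarrow> (MIN N\<in>{..<M}. exp (S N \<alpha>)))"

end

theory Submission
  imports Defs "HOL-Analysis.Kronecker_Approximation_Theorem"
begin

text \<open>
  A unit \<open>\<mu> > 1\<close> of the order attached to \<open>\<alpha>\<close> (from a solution of Pell's equation) acts on integer
  vectors \<open>(n, m)\<close> by unimodular matrices that expand \<open>n\<close> by about \<open>\<mu>\<^sup>k\<close> and contract \<open>n \<alpha> - m\<close>
  by \<open>\<mu>\<^sup>k\<close>. The images \<open>P\<close> of the indices \<open>n\<close> form a grid of mesh about \<open>\<mu>\<^sup>k\<close>.
  Since \<open>\<alpha>\<close> is badly approximable, a box of area \<open>O(1)\<close> in the coordinates \<open>(n, n \<alpha> - m)\<close> contains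
  \<open>O(1)\<close> lattice points. Two consequences are \<open>S P = S n + O(1)\<close>, because \<open>2 S P\<close> is, up to \<open>O(1)\<close>,
  an area minus the number of lattice points in a thin rectangle, and
  \<open>S (P + r) = S P + S r + O(1)\<close> for \<open>r = O(\<mu>\<^sup>k)\<close>.
  Hence \<open>\<Sum>N < \<mu>\<^sup>k. exp (p * S N)\<close> is multiplicative in \<open>k\<close> up to factors
  \<open>exp (O(max 1 \<bar>p\<bar>))\<close>, and a quasi-additive sequence is linear up to its defect. The case \<open>p = \<infinity>\<close>
  is a limit of finite \<open>p\<close>, and \<open>p = -\<infinity>\<close> follows by replacing \<open>S\<close> with \<open>- S\<close>.
\<close>

section \<open>Pell's equation and the powers of a quadratic unit\<close>

section \<open>Units\<close>

text \<open>Dirichlet approximation gives infinitely many pairs \<open>(h, k)\<close> whose norm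
  \<open>h\<^sup>2 - D * k\<^sup>2\<close> is bounded. Two different ones with the same norm
  \<open>n\<close> that are congruent modulo \<open>n\<close> have an integral quotient of norm
  1.\<close>

lemma pell_solution:
  fixes s :: real and D :: int
  assumes s: "s\<^sup>2 = of_int D" "s \<notin> \<rat>"
  obtains x y :: int where "y \<noteq> 0" "x\<^sup>2 - D * y\<^sup>2 = 1"
proof -
  define nm where "nm = (\<lambda>(h, k). h\<^sup>2 - D * k\<^sup>2 :: int)"
  define F where "F = (\<lambda>(h, k). (nm (h, k), h mod nm (h, k), k mod nm (h, k)))"
  define C where "C = \<lceil>2 * \<bar>s\<bar> + 1\<rceil>"
  have nm_real: "of_int (nm (h, k)) = (of_int h - of_int k * s) * (of_int h + of_int k * s)" for h k
    by (simp add: nm_def s(1)[symmetric] power2_eq_square algebra_simps)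
  have nz: "nm (h, k) \<noteq> 0" if "k \<noteq> 0" for h k
  proof
    assume "nm (h, k) = 0"
    then have "(of_int h - of_int k * s) * (of_int h + of_int k * s) = 0"
      using nm_real[of h k] by simp
    then have "of_int k * s = of_int h \<or> of_int k * s = - of_int h"
      unfolding mult_eq_0_iff by linarith
    then have "of_int k * s \<in> \<rat>" by auto
    then have "of_int k * s / of_int k \<in> \<rat>" by (intro Rats_divide) auto
    with that s(2) show False by simp
  qed
  have bound: "\<bar>nm (h, k)\<bar> \<le> C" and pos: "k > 0" if "(h, k) \<in> approx_set s" for h k
  proof -
    from that have k: "k > 0" and a: "\<bar>s - of_int h / of_int k\<bar> < 1 / (of_int k)\<^sup>2"
      by (auto simp: approx_set_def)
    have "of_int h - of_int k * s = - (of_int k * (s - of_int h / of_int k))"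
      using k by (simp add: right_diff_distrib)
    then have "\<bar>of_int h - of_int k * s\<bar> = of_int k * \<bar>s - of_int h / of_int k\<bar>"
      using k by (simp only: abs_minus_cancel abs_mult)
    also have "\<dots> \<le> of_int k * (1 / (of_int k)\<^sup>2)"
      using a k by (intro mult_left_mono) auto
    also have "\<dots> = 1 / of_int k" by (simp add: power2_eq_square)
    finally have d: "\<bar>of_int h - of_int k * s\<bar> \<le> 1 / of_int k" .
    have "\<bar>of_int h + of_int k * s\<bar> \<le> \<bar>of_int h - of_int k * s\<bar> + 2 * \<bar>of_int k * s\<bar>" by linarith
    also have "\<dots> \<le> 1 / of_int k + 2 * (of_int k * \<bar>s\<bar>)"
      using d k by (simp add: abs_mult)
    also have "\<dots> \<le> of_int k * (2 * \<bar>s\<bar> + 1)"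
    proof -
      have "1 / of_int k \<le> (1::real)" "(1::real) \<le> of_int k" using k by auto
      then have "1 / of_int k \<le> (of_int k::real)" by linarith
      then show ?thesis by (simp add: algebra_simps)
    qed
    finally have e: "\<bar>of_int h + of_int k * s\<bar> \<le> of_int k * (2 * \<bar>s\<bar> + 1)" .
    have "\<bar>of_int (nm (h, k))\<bar> \<le> (1 / of_int k) * (of_int k * (2 * \<bar>s\<bar> + 1))"
      unfolding nm_real abs_mult using d e k by (intro mult_mono) auto
    also have "\<dots> = 2 * \<bar>s\<bar> + 1" using k by simp
    finally show "\<bar>nm (h, k)\<bar> \<le> C" unfolding C_def by linarith
    show "k > 0" by fact
  qed
  have "F ` approx_set s \<subseteq> {-C..C} \<times> {-C..C} \<times> {-C..C}"
  proof (rule image_subsetI)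
    fix w assume "w \<in> approx_set s"
    then obtain h k where w: "w = (h, k)" and hk: "(h, k) \<in> approx_set s" by (cases w) auto
    have "\<bar>x mod nm (h, k)\<bar> \<le> C" for x
      using abs_mod_less[of "nm (h, k)" x] nz[of k h] pos[OF hk] bound[OF hk] by linarith
    then show "F w \<in> {-C..C} \<times> {-C..C} \<times> {-C..C}"
      using bound[OF hk] by (auto simp: w F_def abs_le_iff minus_le_iff)
  qed
  then have "finite (F ` approx_set s)" by (rule finite_subset) auto
  then obtain v where v: "v \<in> approx_set s" and "infinite {w \<in> approx_set s. F w = F v}"
    using pigeonhole_infinite[of "approx_set s" F] s(2) rational_iff_finite_approx_set by blast
  then have "infinite ({w \<in> approx_set s. F w = F v} - {v})" by simp
  then have "{w \<in> approx_set s. F w = F v} - {v} \<noteq> {}" by (metis finite.emptyI)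
  then obtain w where w: "w \<in> approx_set s" "F w = F v" "w \<noteq> v" by blast
  obtain h1 k1 h2 k2 where vw: "v = (h1, k1)" "w = (h2, k2)" by fastforce
  define n where "n = nm v"
  have n: "n = h1\<^sup>2 - D * k1\<^sup>2" "n = h2\<^sup>2 - D * k2\<^sup>2"
    and hm: "h2 mod n = h1 mod n" and km: "k2 mod n = k1 mod n"
    using w(2) by (auto simp: n_def vw F_def nm_def)
  have k: "k1 > 0" "k2 > 0" using pos v w(1) vw by auto
  have n0: "n \<noteq> 0" using nz[of k1 h1] k by (simp add: n_def vw)
  obtain i j where ij: "h2 = h1 + n * i" "k2 = k1 + n * j"
    using hm km by (metis mod_eqE mult.commute)
  \<comment> \<open>\<open>x + y * s\<close> is the quotient of \<open>h2 + k2 * s\<close> by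
    \<open>h1 + k1 * s\<close>; the congruences modulo \<open>n\<close> make its coordinates
    integers.\<close>
  define x where "x = 1 + h1 * i - D * (k1 * j)"
  define y where "y = h1 * j - k1 * i"
  have x: "h1 * h2 - D * (k1 * k2) = n * x"
  proof -
    have "h1 * h2 - D * (k1 * k2) = (h1\<^sup>2 - D * k1\<^sup>2) + n * (h1 * i - D * (k1 * j))"
      by (simp add: ij algebra_simps power2_eq_square)
    then show ?thesis by (simp add: n(1)[symmetric] x_def algebra_simps)
  qed
  have y: "h1 * k2 - k1 * h2 = n * y"
    by (simp add: ij y_def algebra_simps)
  have "(n * x)\<^sup>2 - D * (n * y)\<^sup>2 = (h1\<^sup>2 - D * k1\<^sup>2) * (h2\<^sup>2 - D * k2\<^sup>2)"
    unfolding x[symmetric] y[symmetric] by (simp add: algebra_simps power2_eq_square)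
  also have "\<dots> = n\<^sup>2" using n by (simp add: power2_eq_square)
  finally have "n\<^sup>2 * (x\<^sup>2 - D * y\<^sup>2) = n\<^sup>2 * 1" by (simp add: algebra_simps power_mult_distrib)
  then have 1: "x\<^sup>2 - D * y\<^sup>2 = 1" using n0 by simp
  \<comment> \<open>\<open>y = 0\<close> would make the two pairs proportional, and equal norms with
    positive \<open>k1\<close>, \<open>k2\<close> would then make them equal.\<close>
  have "y \<noteq> 0"
  proof
    assume "y = 0"
    with y have e: "h1 * k2 = k1 * h2" by simp
    have "n * k2\<^sup>2 = (h1 * k2)\<^sup>2 - D * (k1 * k2)\<^sup>2" by (simp add: n(1) algebra_simps power_mult_distrib)
    also have "\<dots> = n * k1\<^sup>2" unfolding e by (simp add: n(2) algebra_simps power_mult_distrib)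
    finally have "k2\<^sup>2 = k1\<^sup>2" using n0 by simp
    then have "k2 = k1" using k by simp
    with e k w(3) vw show False by simp
  qed
  from this 1 show ?thesis by (rule that)
qed

text \<open>A unit of norm 1 and its conjugate are inverse to each other, so the powers of one grow
  exactly as the powers of the other shrink.\<close>

lemma unit_powers:
  fixes s :: real and D :: int
  assumes s: "s\<^sup>2 = of_int D" "s \<notin> \<rat>"
  obtains \<mu> :: real and X Y :: "nat \<Rightarrow> int"
  where "\<mu> > 1" "\<And>k. of_int (X k) - of_int (Y k) * s = \<mu> ^ k"
    "\<And>k. of_int (X k) + of_int (Y k) * s = 1 / \<mu> ^ k"
proof -
  obtain x y :: int where y: "y \<noteq> 0" and xy: "x\<^sup>2 - D * y\<^sup>2 = 1"
    by (rule pell_solution[OF s])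
  \<comment> \<open>The signs are chosen so that \<open>- v * s\<close> is positive and adds to
    \<open>u\<close>, which puts the unit \<open>u - v * s\<close> above 1.\<close>
  define u v where "u = \<bar>x\<bar>" and "v = (if s > 0 then - \<bar>y\<bar> else \<bar>y\<bar>)"
  have s0: "s \<noteq> 0" using s(2) by auto
  have uv: "u\<^sup>2 - D * v\<^sup>2 = 1" using xy by (simp add: u_def v_def)
  define \<mu> where "\<mu> = of_int u - of_int v * s"
  have vs: "of_int v * s < 0" using y s0 by (auto simp: v_def mult_less_0_iff)
  have prod: "(of_int u + of_int v * s) * \<mu> = 1"
  proof -
    have "(of_int u + of_int v * s) * \<mu> = of_int (u\<^sup>2 - D * v\<^sup>2)"
      by (simp add: \<mu>_def s(1)[symmetric] power2_eq_square algebra_simps)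
    with uv show ?thesis by simp
  qed
  have "u \<noteq> 0"
  proof
    assume "u = 0"
    then have "(of_int v * s) * (of_int v * s) = -1"
      using prod by (simp add: \<mu>_def)
    then show False using zero_le_square[of "of_int v * s"] by linarith
  qed
  then have "u \<ge> 1" by (simp add: u_def)
  then have l1: "\<mu> > 1" using vs unfolding \<mu>_def by linarith
  have eta: "of_int u + of_int v * s = 1 / \<mu>" using prod l1 by (simp add: field_simps)
  have "\<exists>X Y :: int. of_int X - of_int Y * s = \<mu> ^ k \<and> of_int X + of_int Y * s = 1 / \<mu> ^ k" for k
  proof (induction k)
    case 0
    show ?case by (intro exI[of _ 1] exI[of _ 0]) simp
  next
    case (Suc k)
    then obtain X Y :: int
      where *: "of_int X - of_int Y * s = \<mu> ^ k" "of_int X + of_int Y * s = 1 / \<mu> ^ k" by blast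
    have "of_int (X * u + D * Y * v) - of_int (X * v + Y * u) * s
        = (of_int X - of_int Y * s) * (of_int u - of_int v * s)"
      by (simp add: s(1)[symmetric] power2_eq_square algebra_simps)
    moreover have "of_int (X * u + D * Y * v) + of_int (X * v + Y * u) * s
        = (of_int X + of_int Y * s) * (of_int u + of_int v * s)"
      by (simp add: s(1)[symmetric] power2_eq_square algebra_simps)
    ultimately show ?case
      unfolding * eta \<mu>_def[symmetric]
      by (intro exI[of _ "X * u + D * Y * v"] exI[of _ "X * v + Y * u"]) simp
  qed
  then obtain X Y :: "nat \<Rightarrow> int" where "\<And>k. of_int (X k) - of_int (Y k) * s = \<mu> ^ k"
    "\<And>k. of_int (X k) + of_int (Y k) * s = 1 / \<mu> ^ k" by metis
  with l1 show ?thesis by (rule that)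
qed

section \<open>Linear growth from a bounded additive defect\<close>

section \<open>Quasi-additive sequences\<close>

text \<open>Helly's theorem on the line: the supremum of the left ends lies in every interval, also
  for an infinite family.\<close>

lemma interval_family_common_point:
  fixes l u :: "'i \<Rightarrow> real"
  assumes "\<And>i j. i \<in> I \<Longrightarrow> j \<in> I \<Longrightarrow> l i \<le> u j"
  shows "\<exists>c. \<forall>i\<in>I. l i \<le> c \<and> c \<le> u i"
proof (cases "I = {}")
  case False
  then obtain j where j: "j \<in> I" by blast
  have "bdd_above (l ` I)" by (rule bdd_aboveI[of _ "u j"]) (use assms j in auto)
  then show ?thesis
    by (intro exI[of _ "SUP i\<in>I. l i"]) (auto intro!: cSUP_upper cSUP_least assms False)
qed simp

text \<open>Comparing \<open>a (k * l)\<close> with both \<open>l * a k\<close> and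
  \<open>k * a l\<close> shows that the intervals of radius \<open>E / k\<close> around
  \<open>a k / k\<close> meet pairwise. A common point is the slope.\<close>

lemma quasi_additive_linear:
  fixes a :: "nat \<Rightarrow> real"
  assumes E: "\<And>k l. \<bar>a (k + l) - a k - a l\<bar> \<le> E"
  shows "\<exists>c. \<forall>k. \<bar>a k - c * real k\<bar> \<le> E"
proof -
  have mult: "\<bar>a (Suc m * k) - real (Suc m) * a k\<bar> \<le> real m * E" for m k
  proof (induction m)
    case (Suc m)
    have "\<bar>a (k + Suc m * k) - a k - a (Suc m * k)\<bar> \<le> E" by (rule E)
    with Suc show ?case by (simp add: algebra_simps abs_le_iff)
  qed simp
  have E0: "E \<ge> 0" using E[of 0 0] by simp
  have mult': "\<bar>a (m * k) - real m * a k\<bar> \<le> real m * E" if "m > 0" for m k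
    using mult[of "m - 1" k] that E0 by (cases m) (auto simp: algebra_simps)
  have "(a k - E) / k \<le> (a l + E) / l" if "k > 0" "l > 0" for k l
  proof -
    have "l * a k - k * a l \<le> (k + l) * E"
      using mult'[of l k] mult'[of k l] that by (simp add: mult.commute[of l] distrib_right)
    then show ?thesis using that by (simp add: field_simps)
  qed
  then obtain c where c: "\<And>k. k > 0 \<Longrightarrow> (a k - E) / k \<le> c \<and> c \<le> (a k + E) / k"
    using interval_family_common_point[of "{0<..}" "\<lambda>k. (a k - E) / k" "\<lambda>k. (a k + E) / k"] by auto
  have "\<bar>a k - c * real k\<bar> \<le> E" for k
  proof (cases "k = 0")
    case True
    then show ?thesis using E[of 0 0] by simp
  next
    case False
    with c[of k] show ?thesis by (simp add: field_simps abs_le_iff)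
  qed
  then show ?thesis by blast
qed

section \<open>Exponential sums and maxima of a self-similar sequence\<close>

section \<open>Self-similar sequences\<close>

text \<open>The cutoff is real so that the sum can be taken up to \<open>\<mu> ^ k\<close>; for
  \<open>f = S\<close> and \<open>x = real M\<close> it is the sum inside \<open>J\<close>.\<close>

definition Z :: "(nat \<Rightarrow> real) \<Rightarrow> real \<Rightarrow> real \<Rightarrow> real" where
  "Z f p x = (\<Sum>N | real N < x. exp (p * f N))"

lemma finite_nat_less_real [simp]: "finite {N. real N < x}"
  by (rule finite_subset[of _ "{..nat \<lceil>x\<rceil>}"]) (auto, linarith)

lemma card_nat_less_real: "x \<ge> 0 \<Longrightarrow> real (card {N. real N < x}) \<le> x + 1"
proof -
  assume "x \<ge> 0"
  have "card {N. real N < x} \<le> card {..<nat \<lceil>x\<rceil>}" by (rule card_mono) (auto, linarith)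
  with \<open>x \<ge> 0\<close> show ?thesis by simp linarith
qed

lemma Z_mono: "x \<le> y \<Longrightarrow> Z f p x \<le> Z f p y"
  unfolding Z_def by (intro sum_mono2) auto

text \<open>\<open>g k\<close> embeds the indices as a grid of mesh about \<open>\<mu>\<^sup>k\<close>, along which
  \<open>f\<close> looks like \<open>f\<close> itself and independently of its values on shorter scales.\<close>

locale self_similar =
  fixes f :: "nat \<Rightarrow> real" and \<mu> B :: real and R :: nat and g :: "nat \<Rightarrow> nat \<Rightarrow> nat"
  assumes scale: "\<mu> > 1"
    and f_0: "f 0 = 0"
    and f_step: "\<And>n. \<bar>f (Suc n) - f n\<bar> \<le> 1"
    and g_0: "\<And>k. g k 0 = 0"
    and g_lower: "\<And>k n. \<mu> ^ k * real n \<le> real (g k n)"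
    and g_upper: "\<And>k n. real (g k n) \<le> \<mu> ^ k * (real n + real R)"
    and f_similar: "\<And>k n. \<bar>f (g k n) - f n\<bar> \<le> B"
    and f_additive: "\<And>k n r. real r \<le> (real R + 1) * \<mu> ^ k \<Longrightarrow>
          \<bar>f (g k n + r) - f (g k n) - f r\<bar> \<le> B"
begin

lemma pow_pos [simp]: "\<mu> ^ k > 0" using scale by simp

lemma pow_nonneg [simp]: "\<mu> ^ k \<ge> 0" using scale by simp

lemma B_nonneg: "B \<ge> 0" using f_similar[of 0 0] by linarith

lemma f_bound: "\<bar>f n\<bar> \<le> real n"
proof (induction n)
  case (Suc n)
  with f_step[of n] show ?case by simp
qed (simp add: f_0)

text \<open>Splitting off \<open>r\<close> and replacing \<open>f (g k n)\<close> by
  \<open>f n\<close> cost \<open>B\<close> each. The estimate is two-sided, so it serves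
  \<open>p\<close> of either sign.\<close>

lemma f_split: "real r \<le> (real R + 1) * \<mu> ^ k \<Longrightarrow>
    \<bar>p * f (g k n + r) - p * f n - p * f r\<bar> \<le> 2 * B * \<bar>p\<bar>"
proof -
  assume "real r \<le> (real R + 1) * \<mu> ^ k"
  then have "\<bar>f (g k n + r) - f n - f r\<bar> \<le> 2 * B"
    using f_additive[of r k n] f_similar[of k n] by linarith
  then have "\<bar>p\<bar> * \<bar>f (g k n + r) - f n - f r\<bar> \<le> \<bar>p\<bar> * (2 * B)"
    by (intro mult_left_mono) auto
  then show ?thesis by (simp add: abs_mult[symmetric] algebra_simps)
qed

lemma Z_ge_1: "x > 0 \<Longrightarrow> 1 \<le> Z f p x"
proof -
  assume "x > 0"
  then have "(\<Sum>N\<in>{0}. exp (p * f N)) \<le> Z f p x"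
    unfolding Z_def by (intro sum_mono2) auto
  then show ?thesis by (simp add: f_0)
qed

lemma Z_trivial_bound: "x \<ge> 0 \<Longrightarrow> Z f p x \<le> (x + 1) * exp (\<bar>p\<bar> * x)"
proof -
  assume x: "x \<ge> 0"
  have "exp (p * f N) \<le> exp (\<bar>p\<bar> * x)" if "real N < x" for N
  proof -
    have "p * f N \<le> \<bar>p\<bar> * \<bar>f N\<bar>" by (metis abs_ge_self abs_mult)
    also have "\<dots> \<le> \<bar>p\<bar> * x" using f_bound[of N] that by (intro mult_left_mono) auto
    finally show ?thesis by simp
  qed
  then have "Z f p x \<le> real (card {N. real N < x}) * exp (\<bar>p\<bar> * x)"
    unfolding Z_def by (intro sum_bounded_above) auto
  also have "\<dots> \<le> (x + 1) * exp (\<bar>p\<bar> * x)"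
    using card_nat_less_real[OF x] by (intro mult_right_mono) auto
  finally show ?thesis .
qed

text \<open>Every \<open>N < \<mu> ^ k * x\<close> is a grid point plus a remainder of size
  \<open>O(\<mu> ^ k)\<close>, so the sum over pairs \<open>(n, r)\<close> covers every term;
  covering one twice is harmless since all terms are positive.\<close>

lemma Z_submult:
  "Z f p (\<mu> ^ k * x) \<le> exp (2 * B * \<bar>p\<bar>) * (Z f p x * Z f p ((real R + 2) * \<mu> ^ k))"
proof -
  let ?y = "(real R + 2) * \<mu> ^ k"
  let ?t = "{n. real n < x} \<times> {r. real r < ?y}"
  let ?G = "\<lambda>(n, r). exp (2 * B * \<bar>p\<bar>) * (exp (p * f n) * exp (p * f r))"
  have "\<exists>y\<in>?t. (case y of (n, r) \<Rightarrow> g k n + r) = N \<and> exp (p * f N) \<le> ?G y"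
    if N: "real N < \<mu> ^ k * x" for N
  proof -
    define t where "t = nat \<lfloor>real N / \<mu> ^ k\<rfloor>"
    \<comment> \<open>Stepping back by \<open>R\<close> from the quotient \<open>t\<close> makes
      \<open>g k n \<le> N\<close> by \<open>g_upper\<close>. For \<open>t < R\<close> truncated
      subtraction gives \<open>n = 0\<close>, where \<open>g_0\<close> applies.\<close>
    define n where "n = t - R"
    have "real N / \<mu> ^ k \<ge> 0" using scale by simp
    then have "real t \<le> real N / \<mu> ^ k" "real N / \<mu> ^ k < real t + 1"
      unfolding t_def by linarith+
    then have t1: "\<mu> ^ k * real t \<le> real N" and t2: "real N < \<mu> ^ k * (real t + 1)"
      by (simp_all add: field_simps)
    have gN: "g k n \<le> N"
    proof (cases "t \<ge> R")
      case True
      have "real (g k n) \<le> \<mu> ^ k * (real n + real R)" by (rule g_upper)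
      also have "real n + real R = real t" using True by (simp add: n_def)
      also note t1
      finally show ?thesis by simp
    qed (simp add: n_def g_0)
    define r where "r = N - g k n"
    have N_eq: "N = g k n + r" using gN by (simp add: r_def)
    have "\<mu> ^ k * (real t - real R) \<le> \<mu> ^ k * real n"
      by (intro mult_left_mono) (auto simp: n_def)
    also have "\<dots> \<le> real (g k n)" by (rule g_lower)
    finally have "real r \<le> \<mu> ^ k * (real t + 1) - \<mu> ^ k * (real t - real R)"
      using t2 N_eq by simp
    also have "\<dots> = (real R + 1) * \<mu> ^ k" by (simp add: algebra_simps)
    finally have r: "real r \<le> (real R + 1) * \<mu> ^ k" .
    have "(real R + 1) * \<mu> ^ k < ?y" by (simp add: algebra_simps)
    with r have r': "real r < ?y" by linarith
    have "\<mu> ^ k * real n < \<mu> ^ k * x" using g_lower[of k n] gN N by linarith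
    then have n: "real n < x" by simp
    have "p * f N \<le> 2 * B * \<bar>p\<bar> + (p * f n + p * f r)"
      using f_split[OF r, of p n] N_eq by auto
    then have "exp (p * f N) \<le> ?G (n, r)"
      by (simp flip: exp_add)
    with n r' N_eq show ?thesis by (intro bexI[of _ "(n, r)"]) auto
  qed
  then have "Z f p (\<mu> ^ k * x) \<le> sum ?G ?t"
    unfolding Z_def
    by (intro sum_le_included[where i = "\<lambda>(n, r). g k n + r"]) auto
  also have "\<dots> = exp (2 * B * \<bar>p\<bar>) * (Z f p x * Z f p ?y)"
    unfolding Z_def sum_product sum.cartesian_product by (simp add: case_prod_unfold sum_distrib_left)
  finally show ?thesis .
qed

text \<open>The map \<open>(n, r) \<mapsto> g k n + r\<close> is at most \<open>(R + 1)\<close>-to-one: \<open>n\<close> is determined by its image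
  and by its residue modulo \<open>R + 1\<close>.\<close>
lemma Z_supermult:
  "Z f p x * Z f p (\<mu> ^ k)
    \<le> exp (2 * B * \<bar>p\<bar>) * ((real R + 1) * Z f p (\<mu> ^ k * (x + real R + 1)))"
proof -
  let ?s = "{n. real n < x} \<times> {r. real r < \<mu> ^ k}"
  let ?T = "{N. real N < \<mu> ^ k * (x + real R + 1)}"
  let ?h = "\<lambda>(n, r). (g k n + r, n mod (R + 1))"
  have inj: "inj_on ?h ?s"
  proof (rule inj_onI, clarsimp)
    fix n r m q
    assume r: "real r < \<mu> ^ k" and q: "real q < \<mu> ^ k"
      and eq: "g k n + r = g k m + q" and md: "n mod Suc R = m mod Suc R"
    \<comment> \<open>Equal sums put the two grid points less than \<open>\<mu> ^ k\<close> apart,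
      so their indices differ by at most \<open>R\<close>, less than the modulus.\<close>
    have *: "n < m + Suc R" if "g k n + r = g k m + q" "real q < \<mu> ^ k" for n r m q
    proof -
      have "\<mu> ^ k * real n \<le> real (g k n + r)" using g_lower[of k n] by simp
      also have "\<dots> < \<mu> ^ k * (real m + real R) + \<mu> ^ k"
        using that g_upper[of k m] by simp
      also have "\<dots> = \<mu> ^ k * real (m + Suc R)" by (simp add: algebra_simps)
      finally have "real n < real (m + Suc R)" by simp
      then show ?thesis by linarith
    qed
    have "n < m + Suc R" "m < n + Suc R" using *[OF eq q] *[OF eq[symmetric] r] by auto
    moreover obtain d where "n = m + Suc R * d \<or> m = n + Suc R * d"
      using md by (metis nat_le_linear mod_eq_nat1E)
    ultimately have "n = m" by (cases d) auto
    with eq show "n = m \<and> r = q" by simp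
  qed
  have "Z f p x * Z f p (\<mu> ^ k) = (\<Sum>(n, r)\<in>?s. exp (p * f n) * exp (p * f r))"
    unfolding Z_def by (simp add: sum_product sum.cartesian_product case_prod_unfold)
  also have "\<dots> \<le> (\<Sum>(n, r)\<in>?s. exp (2 * B * \<bar>p\<bar>) * exp (p * f (g k n + r)))"
  proof (rule sum_mono, clarsimp)
    fix n r assume "real n < x" and r: "real r < \<mu> ^ k"
    have "\<mu> ^ k \<le> (real R + 1) * \<mu> ^ k" by (simp add: algebra_simps)
    with r have "real r \<le> (real R + 1) * \<mu> ^ k" by linarith
    then have "p * f n + p * f r \<le> 2 * B * \<bar>p\<bar> + p * f (g k n + r)"
      using f_split[of r k p n] by linarith
    then show "exp (p * f n) * exp (p * f r) \<le> exp (2 * B * \<bar>p\<bar>) * exp (p * f (g k n + r))"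
      by (simp flip: exp_add)
  qed
  also have "\<dots> = exp (2 * B * \<bar>p\<bar>) * (\<Sum>y\<in>?s. exp (p * f (fst (?h y))))"
    by (simp add: sum_distrib_left case_prod_unfold)
  also have "(\<Sum>y\<in>?s. exp (p * f (fst (?h y)))) = (\<Sum>z\<in>?h ` ?s. exp (p * f (fst z)))"
    by (simp only: sum.reindex[OF inj] comp_def)
  also have "\<dots> \<le> (\<Sum>z\<in>?T \<times> {..<R + 1}. exp (p * f (fst z)))"
  proof (intro sum_mono2)
    show "?h ` ?s \<subseteq> ?T \<times> {..<R + 1}"
    proof clarsimp
      fix n r assume n: "real n < x" and r: "real r < \<mu> ^ k"
      have "real (g k n) + real r < \<mu> ^ k * (real n + real R) + \<mu> ^ k"
        using g_upper[of k n] r by simp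
      also have "\<dots> \<le> \<mu> ^ k * (x + real R + 1)"
      proof -
        have "\<mu> ^ k * real n \<le> \<mu> ^ k * x" using n by simp
        then show ?thesis by (simp add: algebra_simps)
      qed
      finally show "real (g k n) + real r < \<mu> ^ k * (x + real R + 1)" .
    qed
  qed auto
  also have "\<dots> = (real R + 1) * Z f p (\<mu> ^ k * (x + real R + 1))"
    unfolding Z_def
    by (simp add: sum.cartesian_product[symmetric, where g = "\<lambda>x y. exp (p * f x)", unfolded case_prod_unfold] sum_distrib_left algebra_simps)
  finally show ?thesis by simp
qed

text \<open>A bound for the finitely many scales that are too short to be split any further.\<close>
definition H :: real where "H = (real R + 2) * \<mu> * \<mu> ^ (SOME s. real R + 2 \<le> \<mu> ^ s) + 1"

lemma H_obtain: obtains s where "real R + 2 \<le> \<mu> ^ s" "(real R + 2) * \<mu> ^ s \<le> H - 1" "\<mu> \<le> H - 1"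
proof -
  define s where "s = (SOME s. real R + 2 \<le> \<mu> ^ s)"
  have "\<exists>s. real R + 2 < \<mu> ^ s" using scale by (rule real_arch_pow)
  then have s: "real R + 2 \<le> \<mu> ^ s"
    unfolding s_def by (metis (mono_tags, lifting) someI_ex less_imp_le)
  have "(real R + 2) * \<mu> ^ s * 1 \<le> (real R + 2) * \<mu> ^ s * \<mu>"
    using scale by (intro mult_left_mono) auto
  then have 1: "(real R + 2) * \<mu> ^ s \<le> H - 1" by (simp add: H_def s_def mult_ac)
  have "1 * \<mu> \<le> ((real R + 2) * \<mu> ^ s) * \<mu>"
  proof (intro mult_right_mono)
    have "1 * 1 \<le> (real R + 2) * \<mu> ^ s"
      using s by (intro mult_mono) auto
    then show "1 \<le> (real R + 2) * \<mu> ^ s" by simp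
  qed (use scale in auto)
  then have "\<mu> \<le> H - 1" by (simp add: H_def s_def mult_ac)
  with s 1 show ?thesis by (rule that)
qed

lemma H_ge_1: "H \<ge> 1"
  using H_obtain scale by (metis add_le_imp_le_diff diff_ge_0_iff_ge less_eq_real_def order_trans zero_le_one)

lemma Z_le_H: "x \<le> H - 1 \<Longrightarrow> Z f p x \<le> H * exp (\<bar>p\<bar> * H)"
proof -
  assume x: "x \<le> H - 1"
  have "Z f p x \<le> Z f p (H - 1)" using x by (rule Z_mono)
  also have "\<dots> \<le> (H - 1 + 1) * exp (\<bar>p\<bar> * (H - 1))"
    using H_ge_1 by (intro Z_trivial_bound) simp
  also have "\<dots> \<le> H * exp (\<bar>p\<bar> * H)"
    using H_ge_1 by (auto intro!: mult_left_mono)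
  finally show ?thesis .
qed

text \<open>On a grid of mesh \<open>\<mu> ^ (k - s)\<close> the enlarged range has boundedly many
  indices, and the remainders stay below \<open>\<mu> ^ k\<close> because \<open>\<mu> ^ s\<close>
  absorbs \<open>R + 2\<close>. For \<open>k < s\<close> the whole range is bounded.\<close>

lemma Z_doubling:
  "Z f p ((real R + 2) * \<mu> ^ k) \<le> exp (2 * B * \<bar>p\<bar>) * (H * exp (\<bar>p\<bar> * H)) * Z f p (\<mu> ^ k)"
proof -
  obtain s where s: "real R + 2 \<le> \<mu> ^ s" "(real R + 2) * \<mu> ^ s \<le> H - 1"
    using H_obtain by metis
  show ?thesis
  proof (cases "s \<le> k")
    case True
    then have k: "\<mu> ^ k = \<mu> ^ (k - s) * \<mu> ^ s" by (simp flip: power_add)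
    have "Z f p ((real R + 2) * \<mu> ^ k) = Z f p (\<mu> ^ (k - s) * ((real R + 2) * \<mu> ^ s))"
      by (simp add: k mult_ac)
    also have "\<dots> \<le> exp (2 * B * \<bar>p\<bar>) *
        (Z f p ((real R + 2) * \<mu> ^ s) * Z f p ((real R + 2) * \<mu> ^ (k - s)))"
      by (rule Z_submult)
    also have "\<dots> \<le> exp (2 * B * \<bar>p\<bar>) * ((H * exp (\<bar>p\<bar> * H)) * Z f p (\<mu> ^ k))"
    proof (intro mult_left_mono mult_mono)
      show "Z f p ((real R + 2) * \<mu> ^ s) \<le> H * exp (\<bar>p\<bar> * H)" using s(2) by (rule Z_le_H)
      have "(real R + 2) * \<mu> ^ (k - s) \<le> \<mu> ^ s * \<mu> ^ (k - s)"
        using s(1) by (intro mult_right_mono) auto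
      then show "Z f p ((real R + 2) * \<mu> ^ (k - s)) \<le> Z f p (\<mu> ^ k)"
        by (intro Z_mono) (simp add: k mult_ac)
    qed (use H_ge_1 in \<open>auto simp: Z_def intro!: sum_nonneg mult_nonneg_nonneg\<close>)
    finally show ?thesis by (simp add: mult_ac)
  next
    case False
    have "(real R + 2) * \<mu> ^ k \<le> (real R + 2) * \<mu> ^ s"
      using False scale by (intro mult_left_mono power_increasing) auto
    then have "Z f p ((real R + 2) * \<mu> ^ k) \<le> H * exp (\<bar>p\<bar> * H)"
      using s(2) by (intro Z_le_H) linarith
    also have "\<dots> \<le> exp (2 * B * \<bar>p\<bar>) * (H * exp (\<bar>p\<bar> * H)) * Z f p (\<mu> ^ k)"
    proof -
      have "1 * (H * exp (\<bar>p\<bar> * H)) * 1 \<le> exp (2 * B * \<bar>p\<bar>) * (H * exp (\<bar>p\<bar> * H)) * Z f p (\<mu> ^ k)"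
        using H_ge_1 B_nonneg Z_ge_1[of "\<mu> ^ k" p] by (intro mult_mono) auto
      then show ?thesis by simp
    qed
    finally show ?thesis .
  qed
qed

text \<open>The defect per unit of \<open>max 1 \<bar>p\<bar>\<close>: \<open>4 * B\<close> from two
  splittings, \<open>H + ln H\<close> from \<open>Z_doubling\<close>, and \<open>ln (R + 1)\<close>
  from the overlap count in \<open>Z_supermult\<close>.\<close>

definition E :: real where "E = 4 * B + H + ln H + ln (real R + 1)"

text \<open>The upper bound rests on \<open>Z_submult\<close>, the lower one on
  \<open>Z_supermult\<close>. Each time a cutoff comes out too large by the factor
  \<open>R + 2\<close>, which \<open>Z_doubling\<close> removes.\<close>

lemma ln_Z_quasi_additive:
  "\<bar>ln (Z f p (\<mu> ^ (k + l))) - ln (Z f p (\<mu> ^ k)) - ln (Z f p (\<mu> ^ l))\<bar> \<le> E * max 1 \<bar>p\<bar>"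
proof -
  define z where "z k = Z f p (\<mu> ^ k)" for k
  have z1: "z k \<ge> 1" for k unfolding z_def by (intro Z_ge_1) simp
  then have z0: "z k > 0" for k using less_le_trans zero_less_one by blast
  have H0: "H > 0" using H_ge_1 by linarith
  have err: "4 * B * \<bar>p\<bar> + ln H + \<bar>p\<bar> * H + ln (real R + 1) \<le> E * max 1 \<bar>p\<bar>"
  proof -
    have "ln H * 1 \<le> ln H * max 1 \<bar>p\<bar>" "ln (real R + 1) * 1 \<le> ln (real R + 1) * max 1 \<bar>p\<bar>"
      "B * \<bar>p\<bar> \<le> B * max 1 \<bar>p\<bar>" "H * \<bar>p\<bar> \<le> H * max 1 \<bar>p\<bar>"
      using H_ge_1 B_nonneg by (intro mult_left_mono; simp)+
    then show ?thesis by (simp add: E_def algebra_simps)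
  qed
  have "z (k + l) \<le> exp (2 * B * \<bar>p\<bar>) * (z k * Z f p ((real R + 2) * \<mu> ^ l))"
    using Z_submult[of p l "\<mu> ^ k"] by (simp add: z_def power_add mult_ac)
  also have "\<dots> \<le> exp (2 * B * \<bar>p\<bar>) * (z k * (exp (2 * B * \<bar>p\<bar>) * (H * exp (\<bar>p\<bar> * H)) * z l))"
    using Z_doubling[of p l] z0[of k] by (intro mult_left_mono) (auto simp: z_def)
  finally have "ln (z (k + l)) \<le> ln \<dots>"
    using z0[of "k + l"] by (simp del: ln_le_cancel_iff add: ln_mono)
  also have "\<dots> = 4 * B * \<bar>p\<bar> + ln H + \<bar>p\<bar> * H + ln (z k) + ln (z l)"
    using z0[of k] z0[of l] H0 by (simp add: ln_mult)
  finally have upper: "ln (z (k + l)) - ln (z k) - ln (z l) \<le> E * max 1 \<bar>p\<bar>"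
    using err ln_ge_zero[of "real R + 1"] by linarith
  have "z k * z l \<le> exp (2 * B * \<bar>p\<bar>) * ((real R + 1) * Z f p (\<mu> ^ l * (\<mu> ^ k + real R + 1)))"
    using Z_supermult[of p "\<mu> ^ k" l] by (simp add: z_def)
  also have "\<dots> \<le> exp (2 * B * \<bar>p\<bar>) * ((real R + 1) * Z f p ((real R + 2) * \<mu> ^ (k + l)))"
  proof (intro mult_left_mono Z_mono)
    have "\<mu> ^ k \<ge> 1" using scale by simp
    then have "(real R + 1) * 1 \<le> (real R + 1) * \<mu> ^ k" by (intro mult_left_mono) auto
    then have "\<mu> ^ l * (\<mu> ^ k + real R + 1) \<le> \<mu> ^ l * ((real R + 2) * \<mu> ^ k)"
      by (intro mult_left_mono) (auto simp: algebra_simps)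
    then show "\<mu> ^ l * (\<mu> ^ k + real R + 1) \<le> (real R + 2) * \<mu> ^ (k + l)"
      by (simp add: power_add mult_ac)
  qed auto
  also have "\<dots> \<le> exp (2 * B * \<bar>p\<bar>) * ((real R + 1) *
      (exp (2 * B * \<bar>p\<bar>) * (H * exp (\<bar>p\<bar> * H)) * z (k + l)))"
    using Z_doubling[of p "k + l"] by (intro mult_left_mono) (auto simp: z_def)
  finally have "ln (z k * z l) \<le> ln \<dots>"
    using z0[of k] z0[of l] by (simp del: ln_le_cancel_iff add: ln_mono)
  also have "\<dots> = 4 * B * \<bar>p\<bar> + ln H + \<bar>p\<bar> * H + ln (real R + 1) + ln (z (k + l))"
    using z0[of "k + l"] H0 by (simp add: ln_mult)
  finally have "ln (z k) + ln (z l) - ln (z (k + l)) \<le> E * max 1 \<bar>p\<bar>"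
    using err z0[of k] z0[of l] by (simp add: ln_mult)
  with upper show ?thesis unfolding z_def by linarith
qed

definition K :: real where "K = 4 * E + 2 * (ln H + H) + 1"

lemma K_pos: "K > 0"
  using B_nonneg H_ge_1 by (simp add: K_def E_def add_nonneg_pos)

text \<open>Linearity in \<open>k\<close> at the scales \<open>\<mu> ^ k\<close> becomes linearity
  in \<open>ln M\<close> by monotonicity: \<open>M\<close> lies between two consecutive scales,
  whose values differ by at most \<open>a 1 + e\<close>.\<close>

lemma ln_Z_asymp:
  "\<exists>C. \<forall>M\<ge>1. \<bar>ln (Z f p (real M)) - C * ln (real M)\<bar> \<le> K * max 1 \<bar>p\<bar>"
proof -
  define a where "a k = ln (Z f p (\<mu> ^ k))" for k
  define e where "e = E * max 1 \<bar>p\<bar>"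
  have qa: "\<bar>a (k + l) - a k - a l\<bar> \<le> e" for k l
    unfolding a_def e_def by (rule ln_Z_quasi_additive)
  then obtain c where c: "\<And>k. \<bar>a k - c * real k\<bar> \<le> e"
    using quasi_additive_linear[of a e] by blast
  have H0: "H > 0" using H_ge_1 by linarith
  have "\<mu> \<le> H - 1" using H_obtain by metis
  then have "Z f p \<mu> \<le> H * exp (\<bar>p\<bar> * H)" by (rule Z_le_H)
  moreover have Z1: "1 \<le> Z f p \<mu>" using scale by (intro Z_ge_1) auto
  ultimately have "a 1 \<le> ln (H * exp (\<bar>p\<bar> * H))"
    by (simp add: a_def del: ln_le_cancel_iff add: ln_mono)
  then have "a 1 \<le> ln H + \<bar>p\<bar> * H" using H0 by (simp add: ln_mult)
  also have "\<dots> \<le> ln H * max 1 \<bar>p\<bar> + max 1 \<bar>p\<bar> * H"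
  proof (intro add_mono mult_right_mono)
    have "ln H * 1 \<le> ln H * max 1 \<bar>p\<bar>" using H_ge_1 by (intro mult_left_mono) auto
    then show "ln H \<le> ln H * max 1 \<bar>p\<bar>" by simp
  qed (use H0 in auto)
  finally have a1: "a 1 \<le> (ln H + H) * max 1 \<bar>p\<bar>" by (simp add: algebra_simps)
  have a1_nonneg: "a 1 \<ge> 0" using Z1 by (simp add: a_def)
  \<comment> \<open>This bound on the slope pays for rounding \<open>x\<close> down to
    \<open>k\<close>.\<close>
  have c_bound: "\<bar>c\<bar> \<le> a 1 + e" using c[of 1] a1_nonneg by auto
  have main: "\<bar>ln (Z f p (real M)) - c / ln \<mu> * ln (real M)\<bar> \<le> K * max 1 \<bar>p\<bar>" if M: "M \<ge> 1" for M
  proof -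
    define x where "x = ln (real M) / ln \<mu>"
    have lm: "ln \<mu> > 0" using scale by simp
    have x0: "x \<ge> 0" using M lm by (simp add: x_def)
    define k where "k = nat \<lfloor>x\<rfloor>"
    have kx: "real k \<le> x" "x < real k + 1" using x0 by (auto simp: k_def)
    have Mx: "real M = \<mu> powr x" using M scale lm by (simp add: x_def powr_def)
    have "\<mu> ^ k \<le> real M" "real M \<le> \<mu> ^ Suc k"
      using kx scale unfolding Mx by (auto simp flip: powr_realpow power_Suc)
    then have "Z f p (\<mu> ^ k) \<le> Z f p (real M)" "Z f p (real M) \<le> Z f p (\<mu> ^ Suc k)"
      by (auto intro: Z_mono)
    moreover have "Z f p (\<mu> ^ k) \<ge> 1" by (intro Z_ge_1) simp
    ultimately have "a k \<le> ln (Z f p (real M))" "ln (Z f p (real M)) \<le> a (Suc k)"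
      by (auto simp: a_def simp del: ln_le_cancel_iff intro!: ln_mono)
    then have "\<bar>ln (Z f p (real M)) - c * real k\<bar> \<le> 2 * e + a 1"
      using c[of k] qa[of k 1] a1_nonneg by simp
    moreover have "\<bar>c * real k - c * x\<bar> \<le> a 1 + e"
    proof -
      have "\<bar>c * real k - c * x\<bar> = \<bar>c\<bar> * \<bar>real k - x\<bar>"
        by (simp add: abs_mult[symmetric] algebra_simps)
      also have "\<dots> \<le> \<bar>c\<bar> * 1" using kx by (intro mult_left_mono) auto
      finally show ?thesis using c_bound by simp
    qed
    ultimately have "\<bar>ln (Z f p (real M)) - c * x\<bar> \<le> 3 * e + 2 * a 1" by linarith
    also have "\<dots> \<le> 4 * e + 2 * ((ln H + H) * max 1 \<bar>p\<bar>) + max 1 \<bar>p\<bar>"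
      using a1 c_bound qa[of 0 0] by linarith
    also have "\<dots> = K * max 1 \<bar>p\<bar>" by (simp add: K_def e_def algebra_simps)
    finally show ?thesis by (simp add: x_def)
  qed
  then show ?thesis by (intro exI[of _ "c / ln \<mu>"] allI impI main)
qed

text \<open>Division by \<open>\<bar>p\<bar>\<close> turns \<open>max 1 \<bar>p\<bar>\<close> into
  \<open>max 1 (1 / \<bar>p\<bar>)\<close>, the shape of the final error.\<close>

lemma ln_Z_asymp_scaled:
  assumes "p \<noteq> 0"
  shows "\<exists>C. \<forall>M\<ge>1. \<bar>ln (Z f p (real M)) / p - C * ln (real M)\<bar> \<le> K * max 1 (1 / \<bar>p\<bar>)"
proof -
  obtain C where C: "\<forall>M\<ge>1. \<bar>ln (Z f p (real M)) - C * ln (real M)\<bar> \<le> K * max 1 \<bar>p\<bar>"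
    using ln_Z_asymp[of p] by (elim exE)
  have "\<bar>ln (Z f p (real M)) / p - C / p * ln (real M)\<bar> \<le> K * max 1 (1 / \<bar>p\<bar>)" if "M \<ge> 1" for M
  proof -
    have "\<bar>ln (Z f p (real M)) / p - C / p * ln (real M)\<bar>
        = \<bar>ln (Z f p (real M)) - C * ln (real M)\<bar> / \<bar>p\<bar>"
      by (subst abs_divide[symmetric]) (simp add: diff_divide_distrib)
    also have "\<dots> \<le> K * max 1 \<bar>p\<bar> / \<bar>p\<bar>" using C that by (intro divide_right_mono) auto
    also have "\<dots> = K * max 1 (1 / \<bar>p\<bar>)" using assms by (cases "\<bar>p\<bar> \<le> 1") (simp_all add: max_def)
    finally show ?thesis .
  qed
  then show ?thesis by (intro exI[of _ "C / p"] allI impI)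
qed

text \<open>With exponent \<open>q = Suc n\<close>, the normalised logarithm lies above the maximum
  by at most \<open>ln M / q\<close>, while its error bound is \<open>K\<close> for all these
  \<open>q\<close>. Letting \<open>q\<close> grow transfers the bound to the maximum.\<close>

lemma Max_asymp: "\<exists>C. \<forall>M\<ge>1. \<bar>(MAX N\<in>{..<M}. f N) - C * ln (real M)\<bar> \<le> K"
proof -
  define m where "m M = (MAX N\<in>{..<M}. f N)" for M
  have "\<exists>C. \<forall>M\<ge>1. \<bar>ln (Z f (real (Suc n)) (real M)) / real (Suc n) - C * ln (real M)\<bar> \<le> K" for n
    using ln_Z_asymp_scaled[of "real (Suc n)"] by simp
  then obtain C where C: "\<And>n M. M \<ge> 1 \<Longrightarrow>
      \<bar>ln (Z f (real (Suc n)) (real M)) / real (Suc n) - C n * ln (real M)\<bar> \<le> K" by metis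
  have approx: "m M \<le> ln (Z f (real (Suc n)) (real M)) / real (Suc n)"
    "ln (Z f (real (Suc n)) (real M)) / real (Suc n) \<le> m M + ln (real M) / real (Suc n)"
    if M: "M \<ge> 1" for M n
  proof -
    let ?q = "real (Suc n)"
    have fin: "finite (f ` {..<M})" "f ` {..<M} \<noteq> {}" using M by (auto simp: lessThan_empty_iff)
    have "m M \<in> f ` {..<M}" unfolding m_def using fin by (intro Max_in)
    then obtain N where N: "N < M" "m M = f N" by blast
    have le: "f i \<le> m M" if "i < M" for i unfolding m_def using that by simp
    have "exp (?q * m M) \<le> Z f ?q (real M)"
      unfolding Z_def N(2) using N(1) by (intro member_le_sum) auto
    moreover have "Z f ?q (real M) > 0" using Z_ge_1[of "real M" ?q] M by simp
    ultimately have "?q * m M \<le> ln (Z f ?q (real M))" by (simp add: ln_ge_iff)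
    then show "m M \<le> ln (Z f ?q (real M)) / ?q" by (simp add: pos_le_divide_eq mult.commute)
    have "Z f ?q (real M) \<le> real (card {N. real N < real M}) * exp (?q * m M)"
      unfolding Z_def by (intro sum_bounded_above) (auto intro!: mult_left_mono le)
    also have "{N. real N < real M} = {..<M}" by auto
    finally have "ln (Z f ?q (real M)) \<le> ln (real M * exp (?q * m M))"
      using \<open>Z f ?q (real M) > 0\<close> by (simp del: ln_le_cancel_iff add: ln_mono)
    also have "\<dots> = ln (real M) + ?q * m M" using M by (simp add: ln_mult)
    finally have "ln (Z f ?q (real M)) / ?q \<le> (ln (real M) + ?q * m M) / ?q"
      by (intro divide_right_mono) auto
    also have "\<dots> = m M + ln (real M) / ?q"
      by (simp add: add_divide_distrib del: of_nat_Suc)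
    finally show "ln (Z f ?q (real M)) / ?q \<le> m M + ln (real M) / ?q" .
  qed
  \<comment> \<open>\<open>C n\<close> lies between the two quotients up to an error
    \<open>1 / Suc n\<close>; eliminating it and letting \<open>n\<close> grow makes the intervals
    meet pairwise. From 2 on the logarithms are positive; \<open>M = 1\<close> is settled by
    \<open>f 0 = 0\<close>.\<close>
  have "(m i - K) / ln (real i) \<le> (m j + K) / ln (real j)" if ij: "i \<ge> 2" "j \<ge> 2" for i j
  proof -
    have li: "ln (real i) > 0" "ln (real j) > 0" using ij by auto
    have "(m i - K) / ln (real i) \<le> (m j + K) / ln (real j) + 1 / real (Suc n)" for n
    proof -
      have "m i - K \<le> C n * ln (real i)" using approx(1)[of i n] C[of i n] ij by linarith
      then have 1: "(m i - K) / ln (real i) \<le> C n" using li by (simp add: pos_divide_le_eq)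
      have "C n * ln (real j) \<le> m j + K + ln (real j) / real (Suc n)"
        using approx(2)[of j n] C[of j n] ij by linarith
      then have "C n \<le> (m j + K + ln (real j) / real (Suc n)) / ln (real j)"
        using li by (simp add: pos_le_divide_eq)
      also have "\<dots> = (m j + K) / ln (real j) + 1 / real (Suc n)"
        using li by (simp add: add_divide_distrib)
      finally show ?thesis using 1 by linarith
    qed
    moreover have "(\<lambda>n. (m j + K) / ln (real j) + 1 / real (Suc n)) \<longlonglongrightarrow> (m j + K) / ln (real j) + 0"
      by (intro tendsto_intros LIMSEQ_Suc lim_1_over_n)
    ultimately show ?thesis by (intro LIMSEQ_le_const[of _ "(m j + K) / ln (real j)"]) auto
  qed
  then obtain c where c: "\<And>i. i \<ge> 2 \<Longrightarrow> (m i - K) / ln (real i) \<le> c \<and> c \<le> (m i + K) / ln (real i)"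
    using interval_family_common_point[of "{2..}" "\<lambda>i. (m i - K) / ln (real i)" "\<lambda>i. (m i + K) / ln (real i)"]
    by auto
  have "\<bar>m M - c * ln (real M)\<bar> \<le> K" if "M \<ge> 1" for M
  proof (cases "M = 1")
    case True
    then have "m M = 0" by (simp add: m_def f_0 lessThan_Suc)
    then show ?thesis using True K_pos by simp
  next
    case False
    then have M: "M \<ge> 2" using that by simp
    then have "ln (real M) > 0" by simp
    then show ?thesis using c[OF M] by (simp add: pos_divide_le_eq pos_le_divide_eq abs_le_iff algebra_simps)
  qed
  then show ?thesis unfolding m_def by (intro exI[of _ c] allI impI)
qed

text \<open>All conditions on \<open>f\<close> survive a change of sign with the same constants;
  this serves the case \<open>p = -\<infinity>\<close>.\<close>

lemma self_similar_uminus: "self_similar (\<lambda>n. - f n) \<mu> B R g"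
proof
  show "\<bar>- f (Suc n) - - f n\<bar> \<le> 1" for n using f_step[of n] by linarith
  show "\<bar>- f (g k n) - - f n\<bar> \<le> B" for k n using f_similar[of k n] by linarith
  show "\<bar>- f (g k n + r) - - f (g k n) - - f r\<bar> \<le> B" if "real r \<le> (real R + 1) * \<mu> ^ k" for k n r
    using f_additive[OF that, of n] by linarith
qed (use scale f_0 g_0 g_lower g_upper in auto)

end

section \<open>Counting lattice points for a badly approximable number\<close>

section \<open>Lattice points and sawtooth sums\<close>

lemma S_0 [simp]: "S 0 \<alpha> = 0" by (simp add: S_def)

lemma S_Suc: "S (Suc n) \<alpha> = S n \<alpha> + (frac (real (Suc n) * \<alpha>) - 1/2)"
  by (simp add: S_def)

lemma S_step: "\<bar>S (Suc n) \<alpha> - S n \<alpha>\<bar> \<le> 1/2"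
  unfolding S_Suc using frac_ge_0[of "real (Suc n) * \<alpha>"] frac_lt_1[of "real (Suc n) * \<alpha>"]
  by linarith

lemma S_shift: "\<bar>S (n + m) \<alpha> - S n \<alpha>\<bar> \<le> real m / 2"
proof (induction m)
  case (Suc m)
  have "real (Suc m) / 2 = real m / 2 + 1 / 2" by simp
  with Suc S_step[of "n + m" \<alpha>] show ?case unfolding add_Suc_right by linarith
qed simp

lemma S_add: "S (n + m) \<alpha> = S n \<alpha> + (\<Sum>j=1..m. frac (real (n + j) * \<alpha>) - 1/2)"
  by (induction m) (simp_all add: S_Suc add_ac)

lemma abs_card_diff_le:
  assumes "finite A" "finite B" "finite U" "A \<subseteq> B \<union> U" "B \<subseteq> A \<union> U"
  shows "\<bar>real (card A) - real (card B)\<bar> \<le> real (card U)"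
proof -
  have "card A \<le> card (B \<union> U)" "card B \<le> card (A \<union> U)" using assms by (auto intro: card_mono)
  then show ?thesis using card_Un_le[of B U] card_Un_le[of A U] by linarith
qed

locale badly_approximable =
  fixes \<alpha> c\<^sub>0 :: real
  assumes c0: "0 < c\<^sub>0" "c\<^sub>0 \<le> 1"
    and bad: "\<And>n m :: int. n \<noteq> 0 \<Longrightarrow> c\<^sub>0 \<le> \<bar>of_int n\<bar> * \<bar>of_int n * \<alpha> - of_int m\<bar>"
begin

lemma not_int: "n \<noteq> 0 \<Longrightarrow> of_int n * \<alpha> \<noteq> of_int m"
  using bad[of n m] c0(1) by auto

lemma frac_pos: "n > 0 \<Longrightarrow> frac (real n * \<alpha>) > 0"
proof -
  assume "n > 0"
  then have "real n * \<alpha> \<noteq> of_int \<lfloor>real n * \<alpha>\<rfloor>"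
    using not_int[of "int n" "\<lfloor>real n * \<alpha>\<rfloor>"] by simp
  then show ?thesis unfolding frac_def using of_int_floor_le[of "real n * \<alpha>"] by linarith
qed

text \<open>In the coordinates \<open>(n, n * \<alpha> - m)\<close> this is a \<open>w\<close> by
  \<open>h\<close> rectangle, and the lattice has covolume 1 there, so the area is the expected
  count.\<close>

definition box :: "real \<Rightarrow> real \<Rightarrow> real \<Rightarrow> real \<Rightarrow> (int \<times> int) set" where
  "box x w y h = {(n, m). x \<le> of_int n \<and> of_int n \<le> x + w \<and>
     y \<le> of_int n * \<alpha> - of_int m \<and> of_int n * \<alpha> - of_int m \<le> y + h}"

text \<open>Distinct points of the box have second coordinates at least \<open>c\<^sub>0 / w\<close>
  apart, so each cell of height \<open>c\<^sub>0 / (2 * w)\<close> holds at most one;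
  \<open>F\<close> numbers the cells.\<close>

lemma card_box:
  assumes w: "w \<ge> 1" and h: "h \<ge> 0"
  shows "finite (box x w y h)" "real (card (box x w y h)) \<le> 2 * w * h / c\<^sub>0 + 1"
proof -
  define F where "F = (\<lambda>(n, m). \<lfloor>(of_int n * \<alpha> - of_int m - y) * (2 * w / c\<^sub>0)\<rfloor>)"
  have pos: "2 * w / c\<^sub>0 > 0" using w c0 by simp
  have inj: "inj_on F (box x w y h)"
  proof (rule inj_onI)
    fix u v assume u: "u \<in> box x w y h" and v: "v \<in> box x w y h" and eq: "F u = F v"
    obtain n m n' m' where uv: "u = (n, m)" "v = (n', m')" by (metis surj_pair)
    define d where "d = of_int (n - n') * \<alpha> - of_int (m - m')"
    have "\<bar>d * (2 * w / c\<^sub>0)\<bar> < 1"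
    proof -
      have "d = (of_int n * \<alpha> - of_int m - y) - (of_int n' * \<alpha> - of_int m' - y)"
        by (simp add: d_def algebra_simps)
      then have "d * (2 * w / c\<^sub>0) = (of_int n * \<alpha> - of_int m - y) * (2 * w / c\<^sub>0)
          - (of_int n' * \<alpha> - of_int m' - y) * (2 * w / c\<^sub>0)"
        by (simp only: left_diff_distrib)
      then show ?thesis using eq unfolding F_def uv prod.case by linarith
    qed
    then have "\<bar>d\<bar> * (2 * w / c\<^sub>0) < 1" using pos by (simp only: abs_mult abs_of_pos)
    then have d: "2 * w * \<bar>d\<bar> < c\<^sub>0" using c0 by (simp add: field_simps)
    have "n = n'"
    proof (rule ccontr)
      assume "n \<noteq> n'"
      then have "c\<^sub>0 \<le> \<bar>of_int (n - n')\<bar> * \<bar>d\<bar>" unfolding d_def by (intro bad) simp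
      also have "\<dots> \<le> w * \<bar>d\<bar>"
        using u v by (intro mult_right_mono) (auto simp: uv box_def)
      also have "\<dots> \<le> 2 * w * \<bar>d\<bar>" using w by simp
      finally show False using d by simp
    qed
    \<comment> \<open>In a single column the gap is a nonzero integer, hence at least 1, which is
      enough because \<open>c\<^sub>0 \<le> 1\<close> and \<open>w \<ge> 1\<close>.\<close>
    moreover have "m = m'"
    proof (rule ccontr)
      assume "m \<noteq> m'"
      then have "1 \<le> \<bar>m - m'\<bar>" by linarith
      then have "1 \<le> \<bar>of_int (m - m') :: real\<bar>" by linarith
      then have "1 \<le> \<bar>d\<bar>" using \<open>n = n'\<close> by (simp add: d_def)
      then have "1 * 1 \<le> 2 * w * \<bar>d\<bar>" using w by (intro mult_mono) auto
      with d c0 show False by simp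
    qed
    ultimately show "u = v" by (simp add: uv)
  qed
  have sub: "F ` box x w y h \<subseteq> {0..\<lfloor>h * (2 * w / c\<^sub>0)\<rfloor>}"
  proof (rule image_subsetI)
    fix v assume v: "v \<in> box x w y h"
    obtain n m where nm: "v = (n, m)" by fastforce
    define d where "d = of_int n * \<alpha> - of_int m - y"
    have "0 \<le> d" "d \<le> h" using v by (auto simp: box_def nm d_def)
    then have "0 \<le> d * (2 * w / c\<^sub>0)" "d * (2 * w / c\<^sub>0) \<le> h * (2 * w / c\<^sub>0)"
      using pos by (auto intro!: mult_nonneg_nonneg mult_right_mono simp del: times_divide_eq_right)
    then show "F v \<in> {0..\<lfloor>h * (2 * w / c\<^sub>0)\<rfloor>}"
      unfolding F_def nm prod.case d_def[symmetric] by (simp add: floor_mono del: times_divide_eq_right)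
  qed
  then have "finite (F ` box x w y h)" by (rule finite_subset) simp
  then show "finite (box x w y h)" using inj by (simp add: finite_image_iff)
  have "card (box x w y h) = card (F ` box x w y h)" using inj by (simp add: card_image)
  also have "\<dots> \<le> card {0..\<lfloor>h * (2 * w / c\<^sub>0)\<rfloor>}" using sub by (intro card_mono) auto
  finally have "real (card (box x w y h)) \<le> real (nat (\<lfloor>h * (2 * w / c\<^sub>0)\<rfloor> + 1))" by simp
  also have "\<dots> \<le> h * (2 * w / c\<^sub>0) + 1"
  proof -
    have "h * (2 * w / c\<^sub>0) \<ge> 0" using h pos by (intro mult_nonneg_nonneg) auto
    then show ?thesis by linarith
  qed
  finally show "real (card (box x w y h)) \<le> 2 * w * h / c\<^sub>0 + 1" by (simp add: mult_ac)
qed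

text \<open>Shifting by \<open>P\<close> rotates the points \<open>j \<alpha>\<close> by the small angle \<open>P \<alpha> - m\<close>,
  which carries only boundedly many of them across an integer.\<close>
lemma S_quasi_additive:
  fixes P r :: nat and m :: int
  assumes \<delta>: "\<bar>real P * \<alpha> - of_int m\<bar> \<le> 1 / L" and L: "L \<ge> 1"
    and r: "real r \<le> T * L" and T: "T \<ge> 1"
  shows "\<bar>S (P + r) \<alpha> - S P \<alpha> - S r \<alpha>\<bar> \<le> T + (4 * T / c\<^sub>0 + 1)"
proof -
  define \<delta> where "\<delta> = real P * \<alpha> - of_int m"
  define e where "e j = \<lfloor>real j * \<alpha> + \<delta>\<rfloor> - \<lfloor>real j * \<alpha>\<rfloor>" for j :: nat
  define A where "A = {j\<in>{1..r}. e j \<noteq> 0}"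
  have \<delta>L: "\<bar>\<delta>\<bar> \<le> 1 / L" using \<delta> by (simp add: \<delta>_def)
  also have "1 / L \<le> 1" using L by simp
  finally have \<delta>1: "\<bar>\<delta>\<bar> \<le> 1" .
  have "frac (real (P + j) * \<alpha>) - frac (real j * \<alpha>) = \<delta> - of_int (e j)" for j
  proof -
    have "real (P + j) * \<alpha> = real j * \<alpha> + \<delta> + of_int m" by (simp add: \<delta>_def algebra_simps)
    then have "frac (real (P + j) * \<alpha>) = frac (real j * \<alpha> + \<delta>)" by (simp add: frac_def)
    then show ?thesis by (simp add: frac_def e_def)
  qed
  then have "S (P + r) \<alpha> - S P \<alpha> - S r \<alpha> = (\<Sum>j=1..r. \<delta> - of_int (e j))"
    unfolding S_add by (simp add: S_def flip: sum_subtractf)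
  also have "\<dots> = real r * \<delta> - (\<Sum>j=1..r. of_int (e j))" by (simp add: sum_subtractf)
  finally have eq: "S (P + r) \<alpha> - S P \<alpha> - S r \<alpha> = real r * \<delta> - (\<Sum>j=1..r. of_int (e j))" .
  have e1: "\<bar>e j\<bar> \<le> 1" for j using \<delta>1 unfolding e_def by linarith
  have "\<bar>\<Sum>j=1..r. of_int (e j) :: real\<bar> \<le> (\<Sum>j=1..r. \<bar>of_int (e j)\<bar>)" by (rule sum_abs)
  also have "\<dots> \<le> (\<Sum>j=1..r. if e j \<noteq> 0 then 1 else 0)"
  proof (rule sum_mono)
    fix j have "\<bar>of_int (e j) :: real\<bar> \<le> 1" using e1[of j] by linarith
    then show "\<bar>of_int (e j)\<bar> \<le> (if e j \<noteq> 0 then 1 else 0 :: real)" by auto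
  qed
  also have "\<dots> = real (card A)" by (simp add: A_def sum.If_cases Int_def)
  \<comment> \<open>The larger of the two floors is the integer crossed and lies within
    \<open>\<bar>\<delta>\<bar>\<close> of \<open>j * \<alpha>\<close>, so each crossing gives a
    point of a box of area \<open>2 * T\<close>.\<close>
  also have "card A \<le> card (box 0 (T * L) (- 1 / L) (2 / L))"
  proof (rule card_inj_on_le)
    let ?h = "\<lambda>j. (int j, max \<lfloor>real j * \<alpha> + \<delta>\<rfloor> \<lfloor>real j * \<alpha>\<rfloor>)"
    show "inj_on ?h A" by (auto intro!: inj_onI)
    show "finite (box 0 (T * L) (- 1 / L) (2 / L))"
      using T L mult_mono[of 1 T 1 L] by (intro card_box) auto
    show "?h ` A \<subseteq> box 0 (T * L) (- 1 / L) (2 / L)"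
    proof (rule image_subsetI)
      fix j assume j: "j \<in> A"
      have "\<bar>real j * \<alpha> - of_int (max \<lfloor>real j * \<alpha> + \<delta>\<rfloor> \<lfloor>real j * \<alpha>\<rfloor>)\<bar> \<le> \<bar>\<delta>\<bar>"
        using j unfolding A_def e_def by (auto simp: max_def) linarith+
      with \<delta>L have "\<bar>real j * \<alpha> - of_int (max \<lfloor>real j * \<alpha> + \<delta>\<rfloor> \<lfloor>real j * \<alpha>\<rfloor>)\<bar> \<le> 1 / L" by linarith
      then show "?h j \<in> box 0 (T * L) (- 1 / L) (2 / L)"
        using j r by (auto simp: box_def A_def abs_le_iff)
    qed
  qed
  also have "real (card (box 0 (T * L) (- 1 / L) (2 / L))) \<le> 2 * (T * L) * (2 / L) / c\<^sub>0 + 1"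
    using T L mult_mono[of 1 T 1 L] by (intro card_box) auto
  also have "\<dots> = 4 * T / c\<^sub>0 + 1" using L by simp
  finally have 1: "\<bar>\<Sum>j=1..r. of_int (e j) :: real\<bar> \<le> 4 * T / c\<^sub>0 + 1" by simp
  have "\<bar>real r * \<delta>\<bar> = real r * \<bar>\<delta>\<bar>" by (simp add: abs_mult)
  also have "\<dots> \<le> (T * L) * (1 / L)" using r \<delta>L T L by (intro mult_mono) auto
  also have "\<dots> = T" using L by simp
  finally show ?thesis using 1 unfolding eq by linarith
qed

text \<open>Half-open in the second coordinate, so that for \<open>\<delta> < 1\<close> at most one
  \<open>l\<close>, the floor of \<open>j * \<alpha>\<close>, belongs to \<open>j\<close>. The range
  of \<open>j\<close> is that of \<open>S (P - 1)\<close>.\<close>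

definition rect :: "nat \<Rightarrow> real \<Rightarrow> (int \<times> int) set" where
  "rect P \<delta> = {(j, l). 1 \<le> j \<and> j < int P \<and> 0 < of_int j * \<alpha> - of_int l \<and> of_int j * \<alpha> - of_int l \<le> \<delta>}"

lemma card_rect:
  assumes "\<delta> < 1"
  shows "finite (rect P \<delta>)" "card (rect P \<delta>) = card {j\<in>{1..<P}. frac (real j * \<alpha>) \<le> \<delta>}"
proof -
  let ?h = "\<lambda>j. (int j, \<lfloor>real j * \<alpha>\<rfloor>)" and ?A = "{j\<in>{1..<P}. frac (real j * \<alpha>) \<le> \<delta>}"
  have "rect P \<delta> = ?h ` ?A"
  proof
    show "?h ` ?A \<subseteq> rect P \<delta>"
    proof (rule image_subsetI)
      fix j assume "j \<in> ?A"
      with frac_pos[of j] show "?h j \<in> rect P \<delta>" by (simp add: rect_def frac_def)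
    qed
    show "rect P \<delta> \<subseteq> ?h ` ?A"
    proof
      fix v assume v: "v \<in> rect P \<delta>"
      obtain j l where jl: "v = (j, l)" by fastforce
      have j: "1 \<le> j" "j < int P" and d: "0 < of_int j * \<alpha> - of_int l" "of_int j * \<alpha> - of_int l \<le> \<delta>"
        using v by (auto simp: jl rect_def)
      have rj: "real (nat j) = of_int j" using j by simp
      have l: "\<lfloor>of_int j * \<alpha>\<rfloor> = l" using d assms by linarith
      have "v = ?h (nat j)" using j l rj by (simp add: jl)
      moreover have "nat j \<in> ?A" using j d l rj by (auto simp: frac_def)
      ultimately show "v \<in> ?h ` ?A" by blast
    qed
  qed
  moreover have "inj_on ?h ?A" by (auto intro: inj_onI)
  ultimately show "finite (rect P \<delta>)" "card (rect P \<delta>) = card ?A"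
    by (simp_all add: card_image)
qed

text \<open>Pair \<open>j\<close> with \<open>P - j\<close>: the two fractional parts add up to \<open>1 + \<delta>\<close> or to \<open>\<delta>\<close>.\<close>
lemma S_eq_card_rect:
  fixes P :: nat and m :: int
  assumes P: "P \<ge> 1" and \<delta>: "real P * \<alpha> = of_int m + \<delta>" "0 < \<delta>" "\<delta> < 1"
  shows "2 * S (P - 1) \<alpha> = real (P - 1) * \<delta> - real (card (rect P \<delta>))"
proof -
  let ?I = "{1..P - 1}"
  have pair: "frac (real j * \<alpha>) + frac (real (P - j) * \<alpha>) - 1
      = \<delta> - (if frac (real j * \<alpha>) \<le> \<delta> then 1 else 0)" if j: "j \<in> ?I" for j
  proof -
    let ?x = "frac (real j * \<alpha>)"
    have x: "?x > 0" "?x < 1" using frac_pos[of j] j frac_lt_1 by auto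
    have "real (P - j) * \<alpha> = of_int (m - \<lfloor>real j * \<alpha>\<rfloor>) + (\<delta> - ?x)"
    proof -
      have "real (P - j) = real P - real j" using j by (auto simp: of_nat_diff)
      then show ?thesis using \<delta>(1) by (simp add: frac_def algebra_simps)
    qed
    moreover have "frac (of_int z + y) = frac y" for z and y :: real by (simp add: frac_def)
    ultimately have "frac (real (P - j) * \<alpha>) = frac (\<delta> - ?x)" by metis
    also have "frac (\<delta> - y) = (if y \<le> \<delta> then \<delta> - y else \<delta> - y + 1)" if "0 < y" "y < 1" for y
      using that \<delta> by (auto simp: frac_unique_iff)
    note this[OF x]
    finally show ?thesis by auto
  qed
  have rev: "(\<Sum>j\<in>?I. frac (real j * \<alpha>)) = (\<Sum>j\<in>?I. frac (real (P - j) * \<alpha>))"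
    using P by (subst sum.atLeastAtMost_rev) simp
  have "2 * S (P - 1) \<alpha> = (\<Sum>j\<in>?I. frac (real j * \<alpha>)) + (\<Sum>j\<in>?I. frac (real j * \<alpha>)) - (\<Sum>j\<in>?I. 1)"
    by (simp add: S_def sum_subtractf)
  also have "\<dots> = (\<Sum>j\<in>?I. frac (real j * \<alpha>) + frac (real (P - j) * \<alpha>) - 1)"
    by (subst (2) rev) (simp add: sum.distrib sum_subtractf)
  also have "\<dots> = (\<Sum>j\<in>?I. \<delta> - (if frac (real j * \<alpha>) \<le> \<delta> then 1 else 0))"
    by (rule sum.cong[OF refl pair])
  also have "\<dots> = real (P - 1) * \<delta> - real (card {j\<in>?I. frac (real j * \<alpha>) \<le> \<delta>})"
    by (simp add: sum_subtractf sum.If_cases Int_def)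
  also have "?I = {1..<P}" using P by auto
  finally show ?thesis using card_rect(2)[OF \<delta>(3)] by simp
qed

text \<open>A unimodular matrix which contracts \<open>n \<alpha> - m\<close> by \<open>L\<close> and expands \<open>n\<close> by about \<open>L\<close>
  maps one rectangle to the other, up to points in two boxes of area \<open>O(1)\<close>.\<close>
lemma S_unimodular:
  fixes p q r s :: int and t L :: real and \<kappa> N P :: nat
  assumes det: "p * s - q * r = 1"
    and contract: "\<And>n m :: int. of_int (p * n + q * m) * \<alpha> - of_int (r * n + s * m)
                    = (of_int n * \<alpha> - of_int m) / L"
    and expand: "\<And>n m :: int. of_int (p * n + q * m) = L * of_int n + t * (of_int n * \<alpha> - of_int m)"
    and t: "\<bar>t\<bar> \<le> real \<kappa> * L" and L: "L \<ge> 1" and \<kappa>: "\<kappa> \<ge> 1" and N: "N > \<kappa>"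
    and P: "int P = p * int N + q * \<lfloor>real N * \<alpha>\<rfloor>"
  shows "\<bar>S P \<alpha> - S N \<alpha>\<bar> \<le> 2 * real \<kappa> + 8 * real \<kappa> / c\<^sub>0 + 3"
proof -
  define \<delta>' where "\<delta>' = frac (real N * \<alpha>)"
  define \<delta> where "\<delta> = \<delta>' / L"
  define m where "m = r * int N + s * \<lfloor>real N * \<alpha>\<rfloor>"
  define F where "F = (\<lambda>(n, l). (p * n + q * l, r * n + s * l))"
  \<comment> \<open>The map moves the first coordinate away from \<open>L * n\<close> by at most
    \<open>\<kappa> * L\<close> on these points, so the two counts can differ only in strips of
    width \<open>2 * \<kappa> * L\<close> around the left and the right edge.\<close>
  define U where "U = box (- real \<kappa> * L) (2 * real \<kappa> * L) 0 (1 / L)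
    \<union> box (L * (real N - real \<kappa>)) (2 * real \<kappa> * L) 0 (1 / L)"
  have \<delta>': "0 < \<delta>'" "\<delta>' < 1" using frac_pos[of N] N frac_lt_1 by (auto simp: \<delta>'_def)
  have \<delta>: "0 < \<delta>" "\<delta> \<le> \<delta>'" "\<delta> \<le> 1 / L"
    using \<delta>' L by (auto simp: \<delta>_def divide_right_mono pos_divide_le_eq intro: mult_left_le[THEN order_trans])
  have t': "\<bar>t * d\<bar> \<le> real \<kappa> * L" if "0 \<le> d" "d \<le> 1" for d
  proof -
    have "\<bar>t * d\<bar> = \<bar>t\<bar> * d" using that by (simp add: abs_mult)
    also have "\<dots> \<le> (real \<kappa> * L) * 1" using t that L by (intro mult_mono) auto
    finally show ?thesis by simp
  qed
  have Nd: "real N * \<alpha> - of_int \<lfloor>real N * \<alpha>\<rfloor> = \<delta>'" by (simp add: \<delta>'_def frac_def)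
  have Pr: "real P = L * real N + t * \<delta>'"
    using expand[of "int N" "\<lfloor>real N * \<alpha>\<rfloor>"] P Nd by (metis of_int_of_nat_eq)
  have Pd: "real P * \<alpha> = of_int m + \<delta>"
    using contract[of "int N" "\<lfloor>real N * \<alpha>\<rfloor>"] P Nd
    by (metis \<delta>_def m_def add.commute diff_eq_eq of_int_of_nat_eq)
  have P_bounds: "L * (real N - real \<kappa>) \<le> real P" "real P \<le> L * (real N - real \<kappa>) + 2 * real \<kappa> * L"
    using t'[of \<delta>'] \<delta>' by (simp_all add: Pr algebra_simps abs_le_iff)
  \<comment> \<open>Here \<open>N > \<kappa>\<close> enters: the image of the right end stays at
    least 1.\<close>
  have "1 * 1 \<le> L * (real N - real \<kappa>)" using L N by (intro mult_mono) auto
  then have P1: "P \<ge> 1" using P_bounds by linarith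
  have \<kappa>L: "1 \<le> 2 * real \<kappa> * L" using mult_mono[of 1 "2 * real \<kappa>" 1 L] \<kappa> L by simp
  have N1: "N \<ge> 1" using N by simp
  \<comment> \<open>A point whose index is in range before the map but not after it, or conversely,
    leaves or enters at the left or the right edge: four cases.\<close>
  have outside: "(x, l) \<in> U"
    if F: "(x, l) = F (j, i)" and d: "0 < of_int j * \<alpha> - of_int i" "of_int j * \<alpha> - of_int i \<le> \<delta>'"
      and range: "(j \<ge> 1 \<and> j < int N \<and> (x < 1 \<or> x \<ge> int P)) \<or> ((j < 1 \<or> j \<ge> int N) \<and> 1 \<le> x \<and> x < int P)"
    for x l j i
  proof -
    let ?d = "of_int j * \<alpha> - of_int i"
    have x: "of_int x = L * of_int j + t * ?d" and xl: "of_int x * \<alpha> - of_int l = ?d / L"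
      using F expand[of j i] contract[of j i] by (auto simp: F_def)
    have td: "\<bar>t * ?d\<bar> \<le> real \<kappa> * L" using d \<delta>' by (intro t') auto
    have dL: "0 \<le> ?d / L" "?d / L \<le> 1 / L" using d \<delta>' L by (auto intro!: divide_right_mono)
    have mono: "L * of_int a \<le> L * of_int b" if "a \<le> b" for a b :: int
      using that L by simp
    have jN: "L * of_int j \<le> L * real N" if "j < int N" using mono[of j "int N"] that by simp
    have jN': "L * of_int j \<ge> L * real N" if "j \<ge> int N" using mono[of "int N" j] that by simp
    have j1: "L * of_int j \<ge> 0" if "j \<ge> 1" using mono[of 0 j] that by simp
    have j1': "L * of_int j \<le> 0" if "j < 1" using mono[of j 0] that by simp
    have xP: "of_int x \<le> real P" if "x < int P" using that by linarith
    have xP': "of_int x \<ge> real P" if "x \<ge> int P" using that by linarith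
    consider "- real \<kappa> * L \<le> of_int x" "of_int x \<le> - real \<kappa> * L + 2 * real \<kappa> * L"
      | "L * (real N - real \<kappa>) \<le> of_int x" "of_int x \<le> L * (real N - real \<kappa>) + 2 * real \<kappa> * L"
    proof -
      have "0 \<le> real \<kappa> * L" using L by simp
      then consider "x < 1" "j \<ge> 1" | "x \<ge> int P" "j < int N" | "j < 1" "1 \<le> x" | "j \<ge> int N" "x < int P"
        using range by blast
      then show thesis
      proof cases
        case 1
        then have "of_int x \<le> (0::real)" by simp
        then show ?thesis by (intro that(1)) (use j1[OF 1(2)] td x \<open>0 \<le> real \<kappa> * L\<close> in linarith)+
      next
        case 2
        then show ?thesis using that(2) jN xP' P_bounds(1) td x by (simp add: abs_le_iff algebra_simps)
      next
        case 3
        then have "of_int x \<ge> (1::real)" by simp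
        moreover have "0 \<le> real \<kappa> * L" using L by simp
        ultimately show ?thesis by (intro that(1)) (use j1'[OF 3(1)] td x in linarith)+
      next
        case 4
        then show ?thesis using that(2) jN' xP P_bounds(2) td x by (simp add: abs_le_iff algebra_simps)
      qed
    qed
    then show ?thesis using dL xl unfolding U_def box_def by cases auto
  qed
  have fin: "finite (rect P \<delta>)" "finite (rect N \<delta>')" using card_rect(1) \<delta> \<delta>' by auto
  have finU: "finite U" unfolding U_def using \<kappa>L L by (auto intro!: card_box)
  have "real (card U) \<le> 2 * (4 * real \<kappa> / c\<^sub>0 + 1)"
  proof -
    have "real (card (box y (2 * real \<kappa> * L) 0 (1 / L))) \<le> 2 * (2 * real \<kappa> * L) * (1 / L) / c\<^sub>0 + 1" for y
      using \<kappa>L L by (intro card_box) auto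
    moreover have "2 * (2 * real \<kappa> * L) * (1 / L) / c\<^sub>0 + 1 = 4 * real \<kappa> / c\<^sub>0 + 1" using L by simp
    ultimately have "real (card (box y (2 * real \<kappa> * L) 0 (1 / L))) \<le> 4 * real \<kappa> / c\<^sub>0 + 1" for y by metis
    then have "real (card (box (- real \<kappa> * L) (2 * real \<kappa> * L) 0 (1 / L)))
        + real (card (box (L * (real N - real \<kappa>)) (2 * real \<kappa> * L) 0 (1 / L)))
        \<le> (4 * real \<kappa> / c\<^sub>0 + 1) + (4 * real \<kappa> / c\<^sub>0 + 1)" by (intro add_mono)
    moreover have "real (card U) \<le> real (card (box (- real \<kappa> * L) (2 * real \<kappa> * L) 0 (1 / L)))
        + real (card (box (L * (real N - real \<kappa>)) (2 * real \<kappa> * L) 0 (1 / L)))"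
      unfolding U_def of_nat_add[symmetric] of_nat_le_iff by (rule card_Un_le)
    ultimately show ?thesis unfolding mult_2 by (rule order_trans[rotated])
  qed
  moreover have "\<bar>real (card (rect P \<delta>)) - real (card (F ` rect N \<delta>'))\<bar> \<le> real (card U)"
  proof (rule abs_card_diff_le)
    show "rect P \<delta> \<subseteq> F ` rect N \<delta>' \<union> U"
    proof
      fix v assume v: "v \<in> rect P \<delta>"
      obtain x l where xl: "v = (x, l)" by fastforce
      \<comment> \<open>The inverse matrix, integral because the determinant is 1.\<close>
      define j i where "j = s * x - q * l" and "i = p * l - r * x"
      have "F (j, i) = ((p * s - q * r) * x, (p * s - q * r) * l)"
        by (simp add: F_def j_def i_def algebra_simps)
      then have F: "v = F (j, i)" by (simp add: det xl)
      have "of_int x * \<alpha> - of_int l = (of_int j * \<alpha> - of_int i) / L"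
        using F contract[of j i] by (auto simp: F_def xl)
      then have "0 < (of_int j * \<alpha> - of_int i) / L" "(of_int j * \<alpha> - of_int i) / L \<le> \<delta>' / L"
        using v by (auto simp: xl rect_def \<delta>_def)
      then have d: "0 < of_int j * \<alpha> - of_int i" "of_int j * \<alpha> - of_int i \<le> \<delta>'"
        using L by (simp_all add: zero_less_divide_iff divide_le_cancel)
      show "v \<in> F ` rect N \<delta>' \<union> U"
      proof (cases "1 \<le> j \<and> j < int N")
        case True
        then have "(j, i) \<in> rect N \<delta>'" using d by (simp add: rect_def)
        then show ?thesis using F by blast
      next
        case False
        have "1 \<le> x" "x < int P" using v by (auto simp: rect_def xl)
        with False have "(x, l) \<in> U" using d F xl by (intro outside) auto
        then show ?thesis by (simp add: xl)
      qed
    qed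
    show "F ` rect N \<delta>' \<subseteq> rect P \<delta> \<union> U"
    proof (rule image_subsetI)
      fix v assume v: "v \<in> rect N \<delta>'"
      obtain j i where ji: "v = (j, i)" by fastforce
      obtain x l where xl: "F v = (x, l)" by fastforce
      have d: "0 < of_int j * \<alpha> - of_int i" "of_int j * \<alpha> - of_int i \<le> \<delta>'"
        and j: "1 \<le> j" "j < int N"
        using v by (auto simp: rect_def ji)
      have "of_int x * \<alpha> - of_int l = (of_int j * \<alpha> - of_int i) / L"
        using xl contract[of j i] by (auto simp: F_def ji)
      then have d': "0 < of_int x * \<alpha> - of_int l" "of_int x * \<alpha> - of_int l \<le> \<delta>"
        using d L by (auto simp: \<delta>_def divide_right_mono)
      show "F v \<in> rect P \<delta> \<union> U"
      proof (cases "1 \<le> x \<and> x < int P")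
        case True
        then show ?thesis using d' by (simp add: rect_def xl)
      next
        case False
        with j have "(x, l) \<in> U" using d xl ji by (intro outside[of x l j i]) auto
        then show ?thesis by (simp add: xl)
      qed
    qed
  qed (use fin finU in auto)
  moreover have "inj F"
  proof (rule injI)
    fix u v assume eq: "F u = F v"
    have "(s * fst (F w) - q * snd (F w), p * snd (F w) - r * fst (F w))
        = ((p * s - q * r) * fst w, (p * s - q * r) * snd w)" for w
      by (simp add: F_def case_prod_unfold algebra_simps)
    then show "u = v" using eq unfolding det by (metis mult_1 prod.collapse)
  qed
  then have "card (F ` rect N \<delta>') = card (rect N \<delta>')" by (intro card_image) (auto intro: inj_on_subset)
  ultimately have cards: "\<bar>real (card (rect P \<delta>)) - real (card (rect N \<delta>'))\<bar> \<le> 8 * real \<kappa> / c\<^sub>0 + 2"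
    by simp
  \<comment> \<open>Expansion and contraction by \<open>L\<close> cancel in the area; only the shear
    term with \<open>t\<close> remains.\<close>
  have "\<bar>real P * \<delta> - real N * \<delta>'\<bar> \<le> real \<kappa>"
  proof -
    have "real P * \<delta> - real N * \<delta>' = (t * \<delta>') * \<delta>' / L"
      using L by (simp add: Pr \<delta>_def field_simps)
    then have "\<bar>real P * \<delta> - real N * \<delta>'\<bar> = \<bar>t * \<delta>'\<bar> * \<delta>' / L"
      using L \<delta>' by (simp add: abs_mult)
    also have "\<dots> \<le> (real \<kappa> * L) * 1 / L"
      using t'[of \<delta>'] \<delta>' L by (intro divide_right_mono mult_mono) auto
    finally show ?thesis using L by simp
  qed
  moreover have "2 * S (P - 1) \<alpha> = real (P - 1) * \<delta> - real (card (rect P \<delta>))"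
    using P1 Pd \<delta> \<delta>' by (intro S_eq_card_rect[of P m]) auto
  moreover have "2 * S (N - 1) \<alpha> = real (N - 1) * \<delta>' - real (card (rect N \<delta>'))"
    using N1 Nd \<delta>' by (intro S_eq_card_rect[of N "\<lfloor>real N * \<alpha>\<rfloor>"]) auto
  moreover have "real (P - 1) * \<delta> = real P * \<delta> - \<delta>" "real (N - 1) * \<delta>' = real N * \<delta>' - \<delta>'"
    using P1 N1 by (simp_all add: of_nat_diff algebra_simps)
  ultimately have "\<bar>2 * S (P - 1) \<alpha> - 2 * S (N - 1) \<alpha>\<bar> \<le> real \<kappa> + 1 + (8 * real \<kappa> / c\<^sub>0 + 2)"
    using cards \<delta> \<delta>' by linarith
  moreover have "\<bar>S P \<alpha> - S (P - 1) \<alpha>\<bar> \<le> 1/2" "\<bar>S N \<alpha> - S (N - 1) \<alpha>\<bar> \<le> 1/2"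
    using S_step[of "P - 1" \<alpha>] S_step[of "N - 1" \<alpha>] P1 N1 by auto
  moreover have "8 * real \<kappa> / c\<^sub>0 \<ge> 0" using c0 by simp
  ultimately show ?thesis by linarith
qed

end

section \<open>The grid generated by a quadratic unit\<close>

section \<open>Quadratic irrationals\<close>

text \<open>Liouville's argument: the integer
  \<open>a * m\<^sup>2 + b * m * n + c * n\<^sup>2\<close> is nonzero for irrational
  \<open>\<alpha>\<close> and has \<open>n * \<alpha> - m\<close> as a factor; when that factor is
  at most 1 in size, the other one is \<open>O(\<bar>n\<bar>)\<close>.\<close>

lemma quadratic_badly_approximable:
  fixes a b c :: int
  assumes a: "a \<noteq> 0" and eq: "of_int a * \<alpha>\<^sup>2 + of_int b * \<alpha> + of_int c = 0" and irr: "\<alpha> \<notin> \<rat>"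
  shows "badly_approximable \<alpha> (1 / (of_int \<bar>a\<bar> + \<bar>2 * of_int a * \<alpha> + of_int b\<bar>))"
proof
  let ?w = "\<bar>2 * of_int a * \<alpha> + of_int b\<bar>"
  have a1: "of_int \<bar>a\<bar> \<ge> (1::real)" using a by linarith
  then show "0 < 1 / (of_int \<bar>a\<bar> + ?w)" "1 / (of_int \<bar>a\<bar> + ?w) \<le> 1" by auto
  fix n m :: int assume n: "n \<noteq> 0"
  then have n1: "\<bar>of_int n\<bar> \<ge> (1::real)" by linarith
  let ?d = "of_int n * \<alpha> - of_int m"
  show "1 / (of_int \<bar>a\<bar> + ?w) \<le> \<bar>of_int n\<bar> * \<bar>?d\<bar>"
  proof (cases "\<bar>?d\<bar> \<le> 1")
    case False
    then have "1 * 1 \<le> \<bar>of_int n\<bar> * \<bar>?d\<bar>" using n1 by (intro mult_mono) auto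
    moreover have "1 / (of_int \<bar>a\<bar> + ?w) \<le> 1" using a1 by simp
    ultimately show ?thesis by linarith
  next
    case True
    \<comment> \<open>This is \<open>- a\<close> times \<open>n * \<alpha>' - m\<close> for the
      conjugate root \<open>\<alpha>' = - b / a - \<alpha>\<close>.\<close>
    let ?e = "of_int n * (2 * of_int a * \<alpha> + of_int b) - of_int a * ?d"
    have "of_int (a * m\<^sup>2 + b * m * n + c * n\<^sup>2) = - ?d * ?e
        + (of_int n)\<^sup>2 * (of_int a * \<alpha>\<^sup>2 + of_int b * \<alpha> + of_int c)"
      by (simp add: algebra_simps power2_eq_square)
    then have form: "of_int (a * m\<^sup>2 + b * m * n + c * n\<^sup>2) = - ?d * ?e" by (simp add: eq)
    have "?d \<noteq> 0"
    proof
      assume "?d = 0"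
      then have "\<alpha> = of_int m / of_int n" using n by (simp add: field_simps)
      with irr show False by (simp add: Rats_divide)
    qed
    moreover have "?e \<noteq> 0"
    proof
      assume "?e = 0"
      then have "\<alpha> = (- of_int m * of_int a - of_int n * of_int b) / (of_int n * of_int a)"
        using n a by (simp add: field_simps)
      also have "\<dots> \<in> \<rat>" by (intro Rats_divide Rats_diff Rats_mult Rats_minus_iff[THEN iffD2] Rats_of_int)
      finally show False using irr by simp
    qed
    ultimately have "- ?d * ?e \<noteq> 0" by simp
    then have "a * m\<^sup>2 + b * m * n + c * n\<^sup>2 \<noteq> 0" using form by (metis of_int_0)
    then have "1 \<le> \<bar>a * m\<^sup>2 + b * m * n + c * n\<^sup>2\<bar>" by linarith
    then have "(1::real) \<le> \<bar>of_int (a * m\<^sup>2 + b * m * n + c * n\<^sup>2)\<bar>" by linarith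
    also have "\<dots> = \<bar>?d\<bar> * \<bar>?e\<bar>" unfolding form abs_mult abs_minus_cancel by (rule refl)
    also have "\<dots> \<le> \<bar>?d\<bar> * (\<bar>of_int n\<bar> * (of_int \<bar>a\<bar> + ?w))"
    proof (rule mult_left_mono)
      have "\<bar>?e\<bar> \<le> \<bar>of_int n * (2 * of_int a * \<alpha> + of_int b)\<bar> + \<bar>of_int a * ?d\<bar>" by (rule abs_triangle_ineq4)
      also have "\<dots> = \<bar>of_int n\<bar> * ?w + of_int \<bar>a\<bar> * \<bar>?d\<bar>" by (simp add: abs_mult)
      also have "\<dots> \<le> \<bar>of_int n\<bar> * ?w + of_int \<bar>a\<bar> * \<bar>of_int n\<bar>"
        using True n1 by (intro add_left_mono mult_left_mono) linarith+
      finally show "\<bar>?e\<bar> \<le> \<bar>of_int n\<bar> * (of_int \<bar>a\<bar> + ?w)" by (simp add: algebra_simps)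
    qed simp
    finally have "1 \<le> (\<bar>of_int n\<bar> * \<bar>?d\<bar>) * (of_int \<bar>a\<bar> + ?w)" by (simp add: mult_ac)
    moreover have "of_int \<bar>a\<bar> + ?w > 0" using a1 by linarith
    ultimately show ?thesis by (simp only: pos_divide_le_eq)
  qed
qed

lemma S_self_similar:
  assumes "quadratic_irrational \<alpha>"
  shows "\<exists>\<mu> B R g. self_similar (\<lambda>n. S n \<alpha>) \<mu> B R g"
proof -
  obtain a b c :: int where irr: "\<alpha> \<notin> \<rat>" and a: "a \<noteq> 0"
    and eq: "of_int a * \<alpha>\<^sup>2 + of_int b * \<alpha> + of_int c = 0"
    using assms unfolding quadratic_irrational_def by blast
  \<comment> \<open>Up to sign, \<open>w\<close> is the square root of the discriminant
    \<open>D\<close>, so Pell's equation for \<open>D\<close> supplies the units.\<close>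
  define w where "w = 2 * of_int a * \<alpha> + of_int b"
  define D where "D = b\<^sup>2 - 4 * a * c"
  have "w\<^sup>2 = 4 * of_int a * (of_int a * \<alpha>\<^sup>2 + of_int b * \<alpha> + of_int c) + of_int D"
    by (simp add: w_def D_def algebra_simps power2_eq_square)
  then have w2: "w\<^sup>2 = of_int D" by (simp add: eq)
  have w_irr: "w \<notin> \<rat>"
  proof
    assume "w \<in> \<rat>"
    then have "(w - of_int b) / (2 * of_int a) \<in> \<rat>" by (intro Rats_divide Rats_diff Rats_mult) auto
    moreover have "(w - of_int b) / (2 * of_int a) = \<alpha>" using a by (simp add: w_def)
    ultimately show False using irr by simp
  qed
  obtain \<mu> :: real and X Y :: "nat \<Rightarrow> int" where \<mu>: "\<mu> > 1"
    and XY: "\<And>k. of_int (X k) - of_int (Y k) * w = \<mu> ^ k" "\<And>k. of_int (X k) + of_int (Y k) * w = 1 / \<mu> ^ k"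
    using unit_powers[OF w2 w_irr] by metis
  define c0 where "c0 = 1 / (of_int \<bar>a\<bar> + \<bar>w\<bar>)"
  interpret badly_approximable \<alpha> c0
    unfolding c0_def w_def using a eq irr by (rule quadratic_badly_approximable)
  \<comment> \<open>\<open>\<kappa>\<close> bounds the shear
    \<open>\<bar>t k\<bar> / \<mu> ^ k\<close>; adding 1 ensures
    \<open>\<kappa> \<ge> 1\<close>.\<close>
  define \<kappa> where "\<kappa> = nat \<lceil>of_int \<bar>a\<bar> / \<bar>w\<bar>\<rceil> + 1"
  \<comment> \<open>The matrix of multiplication by the contracting unit
    \<open>X k + Y k * w\<close> on the numbers \<open>n * \<alpha> - m\<close>; the conjugate unit
    governs the growth of the first coordinate.\<close>
  define p q r s where "p k = X k - Y k * b" and "q k = - (2 * a * Y k)"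
    and "r k = 2 * c * Y k" and "s k = X k + b * Y k" for k
  define t where "t k = (2 * of_int a * of_int (Y k) :: real)" for k
  \<comment> \<open>The shift by \<open>\<kappa>\<close> keeps the shear from pushing the image
    below \<open>\<mu> ^ k * n\<close>; the overshoot is then at most \<open>2 * \<kappa>\<close>
    mesh widths, whence \<open>R = 2 * \<kappa>\<close>. The value at 0 is set by hand, as
    \<open>g_0\<close> demands.\<close>
  define g where "g k n = (if n = 0 then 0
    else nat (p k * int (n + \<kappa>) + q k * \<lfloor>real (n + \<kappa>) * \<alpha>\<rfloor>))" for k n
  have \<mu>1: "\<mu> ^ k \<ge> 1" for k using \<mu> by simp
  have det: "p k * s k - q k * r k = 1" for k
  proof -
    have "(of_int (p k * s k - q k * r k) :: real) = (of_int (X k))\<^sup>2 - (of_int (Y k))\<^sup>2 * of_int D"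
      by (simp add: p_def q_def r_def s_def D_def algebra_simps power2_eq_square)
    also have "\<dots> = (of_int (X k) - of_int (Y k) * w) * (of_int (X k) + of_int (Y k) * w)"
      by (simp add: w2[symmetric] algebra_simps power2_eq_square)
    also have "\<dots> = 1" unfolding XY using \<mu> by simp
    finally show ?thesis by linarith
  qed
  have contract: "of_int (p k * n + q k * m) * \<alpha> - of_int (r k * n + s k * m)
      = (of_int n * \<alpha> - of_int m) / \<mu> ^ k" for k n m
  proof -
    have "of_int (p k * n + q k * m) * \<alpha> - of_int (r k * n + s k * m)
        = (of_int (X k) + of_int (Y k) * w) * (of_int n * \<alpha> - of_int m)
          - 2 * of_int (Y k) * of_int n * (of_int a * \<alpha>\<^sup>2 + of_int b * \<alpha> + of_int c)"
      by (simp add: p_def q_def r_def s_def w_def algebra_simps power2_eq_square)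
    then show ?thesis unfolding eq XY by simp
  qed
  have expand: "of_int (p k * n + q k * m) = \<mu> ^ k * of_int n + t k * (of_int n * \<alpha> - of_int m)" for k n m
    unfolding XY(1)[symmetric] by (simp add: p_def q_def t_def w_def algebra_simps)
  have w0: "\<bar>w\<bar> > 0" using w_irr by auto
  have t: "\<bar>t k\<bar> \<le> real \<kappa> * \<mu> ^ k" for k
  proof -
    have "2 * of_int (Y k) * w = 1 / \<mu> ^ k - \<mu> ^ k" using XY[of k] by linarith
    moreover have "0 < 1 / \<mu> ^ k" "1 / \<mu> ^ k \<le> 1" using \<mu>1[of k] by auto
    ultimately have le: "\<bar>2 * of_int (Y k) * w\<bar> \<le> \<mu> ^ k" using \<mu>1[of k] by linarith
    have "\<bar>t k\<bar> = of_int \<bar>a\<bar> / \<bar>w\<bar> * \<bar>2 * of_int (Y k) * w\<bar>"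
      using w0 by (simp add: t_def abs_mult)
    also have "\<dots> \<le> real \<kappa> * \<mu> ^ k"
    proof (rule mult_mono[OF _ le])
      show "of_int \<bar>a\<bar> / \<bar>w\<bar> \<le> real \<kappa>" unfolding \<kappa>_def by linarith
    qed auto
    finally show ?thesis .
  qed
  have \<kappa>1: "\<kappa> \<ge> 1" by (simp add: \<kappa>_def)
  have real_g: "\<mu> ^ k * real n \<le> of_int (p k * int (n + \<kappa>) + q k * \<lfloor>real (n + \<kappa>) * \<alpha>\<rfloor>)"
    "of_int (p k * int (n + \<kappa>) + q k * \<lfloor>real (n + \<kappa>) * \<alpha>\<rfloor>) \<le> \<mu> ^ k * (real n + real (2 * \<kappa>))" for k n
  proof -
    let ?d = "real (n + \<kappa>) * \<alpha> - of_int \<lfloor>real (n + \<kappa>) * \<alpha>\<rfloor>"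
    have d: "0 \<le> ?d" "?d \<le> 1" by linarith+
    have "\<bar>t k * ?d\<bar> = \<bar>t k\<bar> * ?d" using d by (simp only: abs_mult abs_of_nonneg)
    also have "\<dots> \<le> (real \<kappa> * \<mu> ^ k) * 1" using t[of k] d \<mu> by (intro mult_mono) auto
    finally have td: "\<bar>t k * ?d\<bar> \<le> real \<kappa> * \<mu> ^ k" by simp
    have "of_int (p k * int (n + \<kappa>) + q k * \<lfloor>real (n + \<kappa>) * \<alpha>\<rfloor>)
        = \<mu> ^ k * real n + real \<kappa> * \<mu> ^ k + t k * ?d"
      unfolding expand by (simp add: algebra_simps)
    then show "\<mu> ^ k * real n \<le> of_int (p k * int (n + \<kappa>) + q k * \<lfloor>real (n + \<kappa>) * \<alpha>\<rfloor>)"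
      "of_int (p k * int (n + \<kappa>) + q k * \<lfloor>real (n + \<kappa>) * \<alpha>\<rfloor>) \<le> \<mu> ^ k * (real n + real (2 * \<kappa>))"
      using td by (simp_all add: abs_le_iff distrib_left mult.commute)
  qed
  have int_g: "int (g k n) = p k * int (n + \<kappa>) + q k * \<lfloor>real (n + \<kappa>) * \<alpha>\<rfloor>" if "n > 0" for k n
  proof -
    have "0 \<le> \<mu> ^ k * real n" using \<mu> by simp
    with real_g(1)[of k n] have "(0::real) \<le> of_int (p k * int (n + \<kappa>) + q k * \<lfloor>real (n + \<kappa>) * \<alpha>\<rfloor>)"
      by linarith
    then have "0 \<le> p k * int (n + \<kappa>) + q k * \<lfloor>real (n + \<kappa>) * \<alpha>\<rfloor>" by (simp only: of_int_0_le_iff)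
    then show ?thesis using that by (simp add: g_def)
  qed
  have g_real: "real (g k n) = of_int (p k * int (n + \<kappa>) + q k * \<lfloor>real (n + \<kappa>) * \<alpha>\<rfloor>)" if "n > 0" for k n
    using int_g[OF that, of k] by (metis of_int_of_nat_eq)
  define B1 where "B1 = 2 * real \<kappa> + 8 * real \<kappa> / c0 + 3 + real \<kappa> / 2"
  define T where "T = real (2 * \<kappa>) + 1"
  define B2 where "B2 = T + (4 * T / c0 + 1)"
  have B: "B1 \<ge> 0" "B2 \<ge> 0" using c0 by (simp_all add: B1_def B2_def T_def)
  have "self_similar (\<lambda>n. S n \<alpha>) \<mu> (B1 + B2) (2 * \<kappa>) g"
  proof
    show "\<bar>S (Suc n) \<alpha> - S n \<alpha>\<bar> \<le> 1" for n using S_step[of n \<alpha>] by linarith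
    show "\<mu> ^ k * real n \<le> real (g k n)" for k n
      using real_g(1)[of k n] by (cases "n = 0") (simp_all add: g_real)
    show "real (g k n) \<le> \<mu> ^ k * (real n + real (2 * \<kappa>))" for k n
    proof (cases "n = 0")
      case True
      then show ?thesis using \<mu> by (simp add: g_def)
    next
      case False
      then show ?thesis using real_g(2)[where k = k and n = n] by (simp only: g_real)
    qed
    show "\<bar>S (g k n) \<alpha> - S n \<alpha>\<bar> \<le> B1 + B2" for k n
    proof (cases "n = 0")
      case True
      then show ?thesis using B by (simp add: g_def)
    next
      case False
      then have "\<bar>S (g k n) \<alpha> - S (n + \<kappa>) \<alpha>\<bar> \<le> 2 * real \<kappa> + 8 * real \<kappa> / c0 + 3"
        by (intro S_unimodular[OF det contract expand t \<mu>1 \<kappa>1 _ int_g]) auto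
      then show ?thesis using S_shift[of n \<kappa> \<alpha>] B unfolding B1_def by linarith
    qed
    show "\<bar>S (g k n + j) \<alpha> - S (g k n) \<alpha> - S j \<alpha>\<bar> \<le> B1 + B2"
      if j: "real j \<le> (real (2 * \<kappa>) + 1) * \<mu> ^ k" for k n j
    proof (cases "n = 0")
      case True
      then show ?thesis using B by (simp add: g_def)
    next
      case False
      let ?N = "n + \<kappa>"
      \<comment> \<open>The second row of the matrix supplies the integer close to
        \<open>g k n * \<alpha>\<close>.\<close>
      let ?m = "r k * int ?N + s k * \<lfloor>real ?N * \<alpha>\<rfloor>"
      let ?e = "real ?N * \<alpha> - of_int \<lfloor>real ?N * \<alpha>\<rfloor>"
      have e: "0 \<le> ?e" "?e \<le> 1" by linarith+
      have eq: "real (g k n) * \<alpha> - of_int ?m = ?e / \<mu> ^ k"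
        using False contract[of k "int ?N" "\<lfloor>real ?N * \<alpha>\<rfloor>"] by (simp only: g_real of_int_of_nat_eq)
      have "\<bar>?e / \<mu> ^ k\<bar> = ?e / \<mu> ^ k"
        using e(1) \<mu> by (intro abs_of_nonneg divide_nonneg_nonneg) auto
      also have "\<dots> \<le> 1 / \<mu> ^ k" using e(2) \<mu> by (intro divide_right_mono) auto
      finally have "\<bar>real (g k n) * \<alpha> - of_int ?m\<bar> \<le> 1 / \<mu> ^ k" unfolding eq .
      then have "\<bar>S (g k n + j) \<alpha> - S (g k n) \<alpha> - S j \<alpha>\<bar> \<le> B2"
        unfolding B2_def using \<mu>1[of k] j[folded T_def] by (rule S_quasi_additive) (simp add: T_def)
      then show ?thesis using B by linarith
    qed
  qed (use \<mu> in \<open>simp_all add: g_def\<close>)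
  then show ?thesis by blast
qed

section \<open>The logarithm of \<open>J\<close> for finite and infinite \<open>p\<close>\<close>

lemma ln_J_ereal:
  assumes "r \<noteq> 0" "M \<ge> 1"
  shows "ln (J (ereal r) M \<alpha>) = ln (Z (\<lambda>n. S n \<alpha>) r (real M)) / r"
proof -
  have "(\<Sum>N<M. exp (r * S N \<alpha>)) > 0" using assms by (intro sum_pos) (auto simp: lessThan_empty_iff)
  moreover have "{N. real N < real M} = {..<M}" by auto
  ultimately show ?thesis by (simp add: J_def Z_def ln_powr)
qed

lemma mono_exp: "mono (exp :: real \<Rightarrow> real)" by (intro monoI) simp

lemma ln_J_PInfty: "M \<ge> 1 \<Longrightarrow> ln (J \<infinity> M \<alpha>) = (MAX N\<in>{..<M}. S N \<alpha>)"
proof -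
  assume M: "M \<ge> 1"
  have "exp (MAX N\<in>{..<M}. S N \<alpha>) = Max (exp ` (\<lambda>N. S N \<alpha>) ` {..<M})"
    by (rule mono_Max_commute[OF mono_exp]) (use M in \<open>auto simp: lessThan_empty_iff\<close>)
  then have "J \<infinity> M \<alpha> = exp (MAX N\<in>{..<M}. S N \<alpha>)"
    unfolding J_def PInfty_eq_infinity[symmetric] ereal.case image_image ..
  then show ?thesis by simp
qed

text \<open>The minimum is written as a negated maximum so that the result for maxima applies to
  \<open>- S\<close>.\<close>

lemma ln_J_MInfty: "M \<ge> 1 \<Longrightarrow> ln (J (-\<infinity>) M \<alpha>) = - (MAX N\<in>{..<M}. - S N \<alpha>)"
proof -
  assume M: "M \<ge> 1"
  define A where "A = (\<lambda>N. S N \<alpha>) ` {..<M}"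
  have A: "finite A" "A \<noteq> {}" using M by (auto simp: A_def lessThan_empty_iff)
  have "exp (Min A) = Min (exp ` A)"
    by (rule mono_Min_commute[OF mono_exp A])
  then have "J (-\<infinity>) M \<alpha> = exp (Min A)"
    unfolding J_def A_def MInfty_eq_minfinity[symmetric] ereal.case image_image ..
  moreover have "Min A = - Max (uminus ` A)"
    using A by (intro Min_eqI) (auto simp: minus_le_iff Max_ge_iff minus_Max_eq_Min image_image)
  ultimately show ?thesis by (simp add: A_def image_image)
qed

theorem theorem5:
  fixes \<alpha> :: real
  assumes "quadratic_irrational \<alpha>"
  shows "\<exists>K :: real. K > 0 \<and>
           (\<forall>p :: ereal. p \<noteq> 0 \<longrightarrow>
             (\<exists>C :: real. \<forall>M :: nat. M \<ge> 1 \<longrightarrow>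
               \<bar>ln (J p M \<alpha>) - C * ln (real M)\<bar>
                 \<le> K * max 1 (real_of_ereal (1 / \<bar>p\<bar>))))"
proof -
  obtain \<mu> B R g where ss: "self_similar (\<lambda>n. S n \<alpha>) \<mu> B R g"
    using S_self_similar[OF assms] by blast
  interpret S: self_similar "\<lambda>n. S n \<alpha>" \<mu> B R g by (rule ss)
  interpret U: self_similar "\<lambda>n. - S n \<alpha>" \<mu> B R g by (rule S.self_similar_uminus)
  have "\<exists>C. \<forall>M\<ge>1. \<bar>ln (J p M \<alpha>) - C * ln (real M)\<bar> \<le> S.K * max 1 (real_of_ereal (1 / \<bar>p\<bar>))"
    if p: "p \<noteq> 0" for p
  proof (cases p)
    case (real r)
    then have r: "r \<noteq> 0" using p by auto
    obtain C where C: "\<forall>M\<ge>1. \<bar>ln (Z (\<lambda>n. S n \<alpha>) r (real M)) / r - C * ln (real M)\<bar> \<le> S.K * max 1 (1 / \<bar>r\<bar>)"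
      using S.ln_Z_asymp_scaled[OF r] by (elim exE)
    have "real_of_ereal (1 / \<bar>p\<bar>) = 1 / \<bar>r\<bar>"
      using r by (simp add: real one_ereal_def)
    then show ?thesis
      using C r by (intro exI[of _ C]) (force simp: real ln_J_ereal)
  next
    case PInf
    obtain C where "\<forall>M\<ge>1. \<bar>(MAX N\<in>{..<M}. S N \<alpha>) - C * ln (real M)\<bar> \<le> S.K"
      using S.Max_asymp by (elim exE)
    \<comment> \<open>In \<open>ereal\<close>, \<open>1 / \<infinity>\<close> is 0, so the error
      factor is 1.\<close>
    then show ?thesis by (intro exI[of _ C]) (force simp: PInf ln_J_PInfty)
  next
    case MInf
    \<comment> \<open>\<open>K\<close> is built from \<open>\<mu>\<close>, \<open>B\<close> and
      \<open>R\<close> only, which both interpretations share, so \<open>S.K\<close> is also the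
      constant for \<open>- S\<close>.\<close>
    obtain C where C: "\<forall>M\<ge>1. \<bar>(MAX N\<in>{..<M}. - S N \<alpha>) - C * ln (real M)\<bar> \<le> S.K"
      using U.Max_asymp by (elim exE)
    have "\<bar>ln (J p M \<alpha>) - (- C) * ln (real M)\<bar> \<le> S.K" if "M \<ge> 1" for M
    proof -
      have "\<bar>(MAX N\<in>{..<M}. - S N \<alpha>) - C * ln (real M)\<bar> \<le> S.K" using C that by blast
      then show ?thesis using that by (simp add: MInf ln_J_MInfty)
    qed
    then show ?thesis by (intro exI[of _ "- C"]) (simp add: MInf)
  qed
  with S.K_pos show ?thesis by blast
qed

end
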